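(* 1. Let $R$ be an additively regular (commutative) Krull ring. Then $R$ is length-factorial if and only if $R$ is factorial. 2. Let $R$ be a normalizing (not necessarily commutative) Krull ring. Then $R$ is length-factorial if and only if $R$ is factorial.
   Context: Monoids and factorizations. For a commutative cancellative semigroup $H$ with identity, $H^\times$ is the group of invertible elements and $H_{\mathrm{red}}=\{aH^\times:a\in H\}$. An atom is a non-invertible element $u$ such that $u=ab$ implies $a\in H^\times$ or $b\in H^\times$. Factorizations of $a\in H$ are the elements $z$ of the free abelian monoid on the set of atoms of $H_{\mathrm{red}}$ whose product in $H_{\mathrm{red}}$ is $aH^\times$; the length of $z$ is its number of atoms counted with multiplicity. $H$ is atomic if every element has a factorization, factorial if every element has exactly one factorization, and length-factorial if it is atomic and any two distinct factorizations of any element have distinct lengths. $H$ has one of these properties if and only if $H_{\mathrm{red}}$ has it. Commutative case. Let $R$ be a commutative ring with identity (possibly with zero-divisors), $R^\bullet$ its monoid of regular elements (non-zero-divisors), and $T$ its total quotient ring. $R$ is additively regular if for all $a,b\in R$ with $b$ regular there is $r\in R$ such that $a+br$ is regular. $R$ is a Krull ring if it is completely integrally closed (every $x\in T$ for which there is a regular $c\in R$ with $cx^n\in R$ for all $n\in\mathbb N$ lies in $R$) and satisfies the ascending chain condition on regular divisorial ideals (ideals $I$ of $R$ containing a regular element with $I=(R:(R:I))$, where $(R:X)=\{x\in T: xX\subset R\}$). $R$ is factorial (resp. length-factorial) if $R^\bullet$ is. Noncommutative case. A ring $R$ is normalizing if $aR=Ra$ for all $a\in R$. A prime Goldie ring $R$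 with quotient ring $Q$ is a Krull ring if it is completely integrally closed (equivalently, a maximal order: $\{q\in Q:qI\subset I\}=R=\{q\in Q:Iq\subset I\}$ for every nonzero two-sided ideal $I$ of $R$) and satisfies the ascending chain condition on two-sided divisorial ideals (two-sided ideals $I$ with $I=(I^{-1})^{-1}$, where $I^{-1}=\{q\in Q: qI\subset R\}=\{q\in Q:Iq\subset R\}$). For a normalizing Krull ring $R$ with monoid of regular elements $H$ (so $aH=Ha$ for all $a\in H$), $H_{\mathrm{red}}=\{aH^\times:a\in H\}$ is a commutative cancellative monoid; $R$ is factorial (resp. length-factorial) if $H_{\mathrm{red}}$ is. *)

theory Defs
  imports "HOL-Algebra.Ideal" "HOL-Library.Multiset"
begin

section \<open>Monoids and factorizations\<close>

text \<open>
  For a monoid \<open>H\<close> with \<open>a H = H a\<close> for all \<open>a\<close>, in particular for a commutative one, the set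
  product of \<open>a H\<^sup>\<times>\<close> and \<open>b H\<^sup>\<times>\<close> is \<open>a b H\<^sup>\<times>\<close>.
\<close>

definition reduced_monoid :: "('a, 'm) monoid_scheme \<Rightarrow> 'a set monoid" where
  "reduced_monoid H =
     \<lparr>carrier = {a <#\<^bsub>H\<^esub> Units H | a. a \<in> carrier H}, monoid.mult = set_mult H, one = Units H\<rparr>"

definition atoms :: "('a, 'm) monoid_scheme \<Rightarrow> 'a set" where
  "atoms H = {u \<in> carrier H. u \<notin> Units H \<and>
     (\<forall>a \<in> carrier H. \<forall>b \<in> carrier H. u = a \<otimes>\<^bsub>H\<^esub> b \<longrightarrow> a \<in> Units H \<or> b \<in> Units H)}"

text \<open>
  The free abelian monoid on a set \<open>A\<close> consists of the multisets supported in \<open>A\<close>; the length of a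
  factorization is the \<^const>\<open>size\<close> of the multiset.
\<close>

definition multiset_product :: "('a, 'm) monoid_scheme \<Rightarrow> 'a multiset \<Rightarrow> 'a" where
  "multiset_product M z = (\<Otimes>\<^bsub>M\<^esub>u \<in> set_mset z. u [^]\<^bsub>M\<^esub> count z u)"

definition factorizations :: "('a, 'm) monoid_scheme \<Rightarrow> 'a \<Rightarrow> 'a set multiset set" where
  "factorizations H a =
     {z. set_mset z \<subseteq> atoms (reduced_monoid H) \<and>
         multiset_product (reduced_monoid H) z = a <#\<^bsub>H\<^esub> Units H}"

definition atomic :: "('a, 'm) monoid_scheme \<Rightarrow> bool" where
  "atomic H \<longleftrightarrow> (\<forall>a \<in> carrier H. factorizations H a \<noteq> {})"

definition factorial :: "('a, 'm) monoid_scheme \<Rightarrow> bool" where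
  "factorial H \<longleftrightarrow> (\<forall>a \<in> carrier H. \<exists>!z. z \<in> factorizations H a)"

definition length_factorial :: "('a, 'm) monoid_scheme \<Rightarrow> bool" where
  "length_factorial H \<longleftrightarrow> atomic H \<and>
     (\<forall>a \<in> carrier H. \<forall>z \<in> factorizations H a. \<forall>z' \<in> factorizations H a.
        z \<noteq> z' \<longrightarrow> size z \<noteq> size z')"


section \<open>Regular elements and quotient rings\<close>

definition regular_elements :: "('a, 'm) ring_scheme \<Rightarrow> 'a set" where
  "regular_elements R = {a \<in> carrier R. \<forall>x \<in> carrier R.
     (a \<otimes>\<^bsub>R\<^esub> x = \<zero>\<^bsub>R\<^esub> \<longrightarrow> x = \<zero>\<^bsub>R\<^esub>) \<and> (x \<otimes>\<^bsub>R\<^esub> a = \<zero>\<^bsub>R\<^esub> \<longrightarrow> x = \<zero>\<^bsub>R\<^esub>)}"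

definition regular_monoid :: "('a, 'm) ring_scheme \<Rightarrow> 'a monoid" where
  "regular_monoid R = \<lparr>carrier = regular_elements R, monoid.mult = monoid.mult R, one = \<one>\<^bsub>R\<^esub>\<rparr>"

text \<open>
  \<open>Q\<close> together with the embedding \<open>e\<close> is the classical (two-sided) quotient ring of \<open>R\<close>. If \<open>R\<close> is
  commutative, so is \<open>Q\<close>, and this is the total quotient ring of \<open>R\<close>.
\<close>

definition is_quotient_ring ::
    "('a, 'm) ring_scheme \<Rightarrow> ('b, 'n) ring_scheme \<Rightarrow> ('a \<Rightarrow> 'b) \<Rightarrow> bool" where
  "is_quotient_ring R Q e \<longleftrightarrow>
     ring R \<and> ring Q \<and> e \<in> ring_hom R Q \<and> inj_on e (carrier R) \<and>
     (\<forall>s \<in> regular_elements R. e s \<in> Units Q) \<and>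
     (\<forall>q \<in> carrier Q.
        (\<exists>a \<in> carrier R. \<exists>s \<in> regular_elements R. q = e a \<otimes>\<^bsub>Q\<^esub> inv\<^bsub>Q\<^esub> (e s)) \<and>
        (\<exists>a \<in> carrier R. \<exists>s \<in> regular_elements R. q = inv\<^bsub>Q\<^esub> (e s) \<otimes>\<^bsub>Q\<^esub> e a))"

text \<open>
  \<open>R\<close> is identified with its image under \<open>e\<close>, and \<open>X\<close> is a subset of \<open>Q\<close>. In the noncommutative
  case this is \<open>{q. q X \<subseteq> R}\<close>; if \<open>R\<close> is a maximal order in \<open>Q\<close>, it agrees with \<open>{q. X q \<subseteq> R}\<close>
  both for \<open>X = I\<close> and for \<open>X = I\<^sup>-\<^sup>1\<close>, where \<open>I\<close> is a nonzero two-sided ideal. Whether the zero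
  ideal counts as divisorial does not affect the chain condition.
\<close>

definition ideal_inverse ::
    "('a, 'm) ring_scheme \<Rightarrow> ('b, 'n) ring_scheme \<Rightarrow> ('a \<Rightarrow> 'b) \<Rightarrow> 'b set \<Rightarrow> 'b set" where
  "ideal_inverse R Q e X = {q \<in> carrier Q. \<forall>x \<in> X. q \<otimes>\<^bsub>Q\<^esub> x \<in> e ` carrier R}"

definition divisorial ::
    "('a, 'm) ring_scheme \<Rightarrow> ('b, 'n) ring_scheme \<Rightarrow> ('a \<Rightarrow> 'b) \<Rightarrow> 'a set \<Rightarrow> bool" where
  "divisorial R Q e I \<longleftrightarrow> ideal I R \<and>
     e ` I = ideal_inverse R Q e (ideal_inverse R Q e (e ` I))"

definition ascending_chain_condition :: "'a set set \<Rightarrow> bool" where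
  "ascending_chain_condition F \<longleftrightarrow>
     (\<forall>I :: nat \<Rightarrow> 'a set. mono I \<and> range I \<subseteq> F \<longrightarrow> (\<exists>N. \<forall>n \<ge> N. I n = I N))"


section \<open>Commutative Krull rings, possibly with zero-divisors\<close>

definition additively_regular :: "('a, 'm) ring_scheme \<Rightarrow> bool" where
  "additively_regular R \<longleftrightarrow>
     (\<forall>a \<in> carrier R. \<forall>b \<in> regular_elements R.
        \<exists>r \<in> carrier R. a \<oplus>\<^bsub>R\<^esub> b \<otimes>\<^bsub>R\<^esub> r \<in> regular_elements R)"

definition completely_integrally_closed ::
    "('a, 'm) ring_scheme \<Rightarrow> ('b, 'n) ring_scheme \<Rightarrow> ('a \<Rightarrow> 'b) \<Rightarrow> bool" where
  "completely_integrally_closed R T e \<longleftrightarrow>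
     (\<forall>x \<in> carrier T.
        (\<exists>c \<in> regular_elements R. \<forall>n :: nat. e c \<otimes>\<^bsub>T\<^esub> x [^]\<^bsub>T\<^esub> n \<in> e ` carrier R) \<longrightarrow>
        x \<in> e ` carrier R)"

text \<open>
  The quotient ring is unique up to isomorphism over \<open>R\<close>, and each of its elements is given by a pair
  (numerator, denominator) of elements of \<open>R\<close>. Hence a copy of it always lives on a set of sets of
  such pairs, and the choice of this carrier type in the next definition and in the noncommutative
  one below is no restriction.
\<close>

definition comm_krull_ring :: "('a, 'm) ring_scheme \<Rightarrow> bool" where
  "comm_krull_ring R \<longleftrightarrow> cring R \<and>
     (\<exists>(T :: ('a \<times> 'a) set ring) e.
        is_quotient_ring R T e \<and>
        completely_integrally_closed R T e \<and>
        ascending_chain_condition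
          {I. divisorial R T e I \<and> I \<inter> regular_elements R \<noteq> {}})"


section \<open>Noncommutative Krull rings\<close>

definition normalizing :: "('a, 'm) ring_scheme \<Rightarrow> bool" where
  "normalizing R \<longleftrightarrow> (\<forall>a \<in> carrier R. a <#\<^bsub>R\<^esub> carrier R = carrier R #>\<^bsub>R\<^esub> a)"

definition prime_ring :: "('a, 'm) ring_scheme \<Rightarrow> bool" where
  "prime_ring R \<longleftrightarrow> ring R \<and> \<one>\<^bsub>R\<^esub> \<noteq> \<zero>\<^bsub>R\<^esub> \<and>
     (\<forall>a \<in> carrier R. \<forall>b \<in> carrier R.
        (\<forall>x \<in> carrier R. a \<otimes>\<^bsub>R\<^esub> x \<otimes>\<^bsub>R\<^esub> b = \<zero>\<^bsub>R\<^esub>) \<longrightarrow> a = \<zero>\<^bsub>R\<^esub> \<or> b = \<zero>\<^bsub>R\<^esub>)"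

definition left_ideal :: "('a, 'm) ring_scheme \<Rightarrow> 'a set \<Rightarrow> bool" where
  "left_ideal R L \<longleftrightarrow> additive_subgroup L R \<and> (\<forall>r \<in> carrier R. \<forall>x \<in> L. r \<otimes>\<^bsub>R\<^esub> x \<in> L)"

definition left_annihilator :: "('a, 'm) ring_scheme \<Rightarrow> 'a set \<Rightarrow> 'a set" where
  "left_annihilator R S = {x \<in> carrier R. \<forall>s \<in> S. x \<otimes>\<^bsub>R\<^esub> s = \<zero>\<^bsub>R\<^esub>}"

text \<open>
  The ascending chain condition on left annihilators, and no infinite direct sum of nonzero left
  ideals.
\<close>

definition left_goldie :: "('a, 'm) ring_scheme \<Rightarrow> bool" where
  "left_goldie R \<longleftrightarrow>
     ascending_chain_condition {left_annihilator R S | S. S \<subseteq> carrier R} \<and>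
     \<not> (\<exists>L :: nat \<Rightarrow> 'a set.
          (\<forall>n. left_ideal R (L n) \<and> L n \<noteq> {\<zero>\<^bsub>R\<^esub>}) \<and>
          (\<forall>n x. (\<forall>i \<le> n. x i \<in> L i) \<and> (\<Oplus>\<^bsub>R\<^esub>i \<in> {..n}. x i) = \<zero>\<^bsub>R\<^esub> \<longrightarrow>
             (\<forall>i \<le> n. x i = \<zero>\<^bsub>R\<^esub>)))"

definition opposite_ring :: "('a, 'm) ring_scheme \<Rightarrow> ('a, 'm) ring_scheme" where
  "opposite_ring R = R\<lparr>monoid.mult := \<lambda>x y. y \<otimes>\<^bsub>R\<^esub> x\<rparr>"

definition goldie_ring :: "('a, 'm) ring_scheme \<Rightarrow> bool" where
  "goldie_ring R \<longleftrightarrow> ring R \<and> left_goldie R \<and> left_goldie (opposite_ring R)"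

definition maximal_order ::
    "('a, 'm) ring_scheme \<Rightarrow> ('b, 'n) ring_scheme \<Rightarrow> ('a \<Rightarrow> 'b) \<Rightarrow> bool" where
  "maximal_order R Q e \<longleftrightarrow>
     (\<forall>I. ideal I R \<and> I \<noteq> {\<zero>\<^bsub>R\<^esub>} \<longrightarrow>
        {q \<in> carrier Q. \<forall>x \<in> I. q \<otimes>\<^bsub>Q\<^esub> e x \<in> e ` I} = e ` carrier R \<and>
        {q \<in> carrier Q. \<forall>x \<in> I. e x \<otimes>\<^bsub>Q\<^esub> q \<in> e ` I} = e ` carrier R)"

definition krull_ring :: "('a, 'm) ring_scheme \<Rightarrow> bool" where
  "krull_ring R \<longleftrightarrow> prime_ring R \<and> goldie_ring R \<and>
     (\<exists>(Q :: ('a \<times> 'a) set ring) e.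
        is_quotient_ring R Q e \<and>
        maximal_order R Q e \<and>
        ascending_chain_condition {I. divisorial R Q e I})"

end

theory Submission
  imports Defs "HOL-Algebra.Divisibility" "HOL-Algebra.Subrings"
begin

text \<open>
  In a length-factorial reduced monoid that is not factorial, all relations between factorizations
  are generated by a single one, \<open>a z' = b w'\<close> with atoms \<open>a\<close>, \<open>b\<close>, whose two sides have no atom in
  common. Adding \<open>a w'\<close> to both sides gives \<open>a (z' + w') = w' (b + a)\<close>, and factoring \<open>z' + w'\<close> and
  \<open>b + a\<close> yields a relation that is not of the required form, because neither \<open>a\<close> nor \<open>b\<close> divides
  \<open>b + a\<close>. With zero-divisors, \<open>b + a\<close> may fail to be regular and is replaced by \<open>b + a (1 + b r)\<close>
  for a suitable \<open>r\<close>. A normalizing prime ring is a domain; there the argument works up to units,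
  and the Krull property is needed only to see that \<open>a b\<close> and \<open>b a\<close> differ by a unit. The latter
  is local at the maximal ideals of the form \<open>{r. q r \<in> R}\<close>, at which the value group is cyclic.
\<close>

section \<open>Length-factorial reduced monoids\<close>

text \<open>In the noncommutative case the obstacle is that normality alone does not relate
  \<open>a \<otimes> b\<close> and \<open>b \<otimes> a\<close> by units: in a normalizing valuation
  domain with noncommutative value group the two products can have different values. The quotient
  \<open>c = a \<otimes> b \<otimes> inv (b \<otimes> a)\<close> is therefore studied through the
  ideal of all \<open>r\<close> in \<open>R\<close> with \<open>c \<otimes> r \<in> R\<close>. This
  ideal is all of \<open>R\<close> exactly if \<open>c \<in> R\<close>. Otherwise the chain
  condition puts it inside a maximal ideal \<open>P\<close> of the same kind, belonging to some
  \<open>q\<close>. The exponent \<open>n\<close> with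
  \<open>q [^] n \<otimes> r \<in> R - P\<close> behaves like an additive valuation of
  \<open>r\<close> and so does not see the order of factors; this produces an element of the ideal
  outside \<open>P\<close>, a contradiction. Interchanging \<open>a\<close> and \<open>b\<close>
  then makes the factor between the two products a unit.\<close>

text \<open>
  The only property of rings that enters: in a domain, a relation \<open>a z = b w\<close> gives
  \<open>a (z + w) = w (b + a)\<close>, and \<open>b + a\<close> is divisible by neither \<open>a\<close> nor \<open>b\<close> unless one of them
  divides the other.
\<close>

definition exchange :: "('a, 'm) monoid_scheme \<Rightarrow> bool" where
  "exchange H \<longleftrightarrow>
     (\<forall>a \<in> carrier H. \<forall>b \<in> carrier H. \<forall>z \<in> carrier H. \<forall>w \<in> carrier H.
        a \<otimes>\<^bsub>H\<^esub> z = b \<otimes>\<^bsub>H\<^esub> w \<and> \<not> a divides\<^bsub>H\<^esub> b \<and> \<not> b divides\<^bsub>H\<^esub> a \<longrightarrow>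
        (\<exists>x \<in> carrier H. \<exists>y \<in> carrier H.
           a \<otimes>\<^bsub>H\<^esub> x = w \<otimes>\<^bsub>H\<^esub> y \<and> \<not> a divides\<^bsub>H\<^esub> y \<and> \<not> b divides\<^bsub>H\<^esub> y))"

lemma exchangeE:
  assumes "exchange H" "a \<in> carrier H" "b \<in> carrier H" "z \<in> carrier H" "w \<in> carrier H"
    "a \<otimes>\<^bsub>H\<^esub> z = b \<otimes>\<^bsub>H\<^esub> w" "\<not> a divides\<^bsub>H\<^esub> b" "\<not> b divides\<^bsub>H\<^esub> a"
  obtains x y where "x \<in> carrier H" "y \<in> carrier H" "a \<otimes>\<^bsub>H\<^esub> x = w \<otimes>\<^bsub>H\<^esub> y"
    "\<not> a divides\<^bsub>H\<^esub> y" "\<not> b divides\<^bsub>H\<^esub> y"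
  using assms unfolding exchange_def by blast

lemma factorial_imp_length_factorial: "factorial H \<Longrightarrow> length_factorial H"
  unfolding factorial_def length_factorial_def atomic_def by blast

lemma set_mset_repeat_mset_subset: "set_mset (repeat_mset n x) \<subseteq> set_mset x"
  by (auto simp flip: count_greater_zero_iff)

section \<open>Products of multisets in a commutative monoid\<close>

context comm_monoid
begin

text \<open>Elements outside \<open>set_mset z\<close> enter with exponent 0; this provides a common
  index set for two multisets.\<close>

lemma multiset_product_superset:
  assumes "finite A" "set_mset z \<subseteq> A" "A \<subseteq> carrier G"
  shows "multiset_product G z = (\<Otimes>u\<in>A. u [^] count z u)"
  unfolding multiset_product_def
  by (rule finprod_mono_neutral_cong_left) (use assms in \<open>auto simp: not_in_iff\<close>)

lemma multiset_product_closed: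
  assumes "set_mset z \<subseteq> carrier G"
  shows "multiset_product G z \<in> carrier G"
  unfolding multiset_product_def using assms by (intro finprod_closed) auto

lemma multiset_product_empty [simp]: "multiset_product G {#} = \<one>"
  by (simp add: multiset_product_def)

lemma multiset_product_union:
  assumes "set_mset x \<subseteq> carrier G" "set_mset y \<subseteq> carrier G"
  shows "multiset_product G (x + y) = multiset_product G x \<otimes> multiset_product G y"
proof -
  let ?A = "set_mset x \<union> set_mset y"
  have "multiset_product G (x + y) = (\<Otimes>u\<in>?A. u [^] count (x + y) u)"
    by (rule multiset_product_superset) (use assms in auto)
  also have "\<dots> = (\<Otimes>u\<in>?A. u [^] count x u \<otimes> u [^] count y u)"
    by (rule finprod_cong') (use assms in \<open>auto simp: nat_pow_mult\<close>)
  also have "\<dots> = (\<Otimes>u\<in>?A. u [^] count x u) \<otimes> (\<Otimes>u\<in>?A. u [^] count y u)"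
    by (rule finprod_multf) (use assms in auto)
  also have "(\<Otimes>u\<in>?A. u [^] count x u) = multiset_product G x"
    by (rule multiset_product_superset [symmetric]) (use assms in auto)
  also have "(\<Otimes>u\<in>?A. u [^] count y u) = multiset_product G y"
    by (rule multiset_product_superset [symmetric]) (use assms in auto)
  finally show ?thesis .
qed

lemma multiset_product_add_mset:
  assumes "u \<in> carrier G" "set_mset x \<subseteq> carrier G"
  shows "multiset_product G (add_mset u x) = u \<otimes> multiset_product G x"
proof -
  have "multiset_product G {#u#} = u"
    using assms(1) multiset_product_superset[of "{u}" "{#u#}"] by simp
  then show ?thesis
    using multiset_product_union[of "{#u#}" x] assms by simp
qed

lemma multiset_product_repeat_cong:
  assumes "set_mset x \<subseteq> carrier G" "set_mset y \<subseteq> carrier G"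
    "multiset_product G x = multiset_product G y"
  shows "multiset_product G (repeat_mset n x) = multiset_product G (repeat_mset n y)"
proof (induction n)
  case (Suc n)
  have "set_mset (repeat_mset n x) \<subseteq> carrier G" "set_mset (repeat_mset n y) \<subseteq> carrier G"
    using assms by (meson order_trans set_mset_repeat_mset_subset)+
  then show ?case
    using Suc assms by (simp add: multiset_product_union)
qed simp

lemma member_divides_multiset_product:
  assumes "set_mset x \<subseteq> carrier G" "u \<in># x"
  shows "u divides multiset_product G x"
proof -
  obtain y where y: "x = add_mset u y" using assms(2) by (meson mset_add)
  then have "multiset_product G x = u \<otimes> multiset_product G y" "multiset_product G y \<in> carrier G"
    using assms(1) by (auto simp: multiset_product_add_mset multiset_product_closed)
  then show ?thesis by (auto simp: factor_def)
qed

end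

lemma atoms_subset: "atoms H \<subseteq> carrier H"
  by (auto simp: atoms_def)

text \<open>
  A length-factorial monoid that is not factorial has a relation \<open>z = w\<close> with disjoint sides which
  generates all relations between factorizations: take the difference of the lengths minimal and
  divide the length difference of any other relation by it.
\<close>

lemma (in comm_monoid_cancel) master_relation:
  assumes lf: "\<And>x y. \<lbrakk>set_mset x \<subseteq> A; set_mset y \<subseteq> A; multiset_product G x = multiset_product G y;
      size x = size y\<rbrakk> \<Longrightarrow> x = y"
    and A: "A \<subseteq> carrier G"
    and ex: "set_mset x0 \<subseteq> A" "set_mset y0 \<subseteq> A" "multiset_product G x0 = multiset_product G y0" "x0 \<noteq> y0"
  obtains z w where "set_mset z \<subseteq> A" "set_mset w \<subseteq> A" "multiset_product G z = multiset_product G w"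
    "size w < size z" "z \<inter># w = {#}"
    "\<And>x y. \<lbrakk>set_mset x \<subseteq> A; set_mset y \<subseteq> A; multiset_product G x = multiset_product G y\<rbrakk> \<Longrightarrow>
       x = y \<or> (z \<subseteq># x \<and> w \<subseteq># y) \<or> (z \<subseteq># y \<and> w \<subseteq># x)"
proof -
  define rel where "rel x y \<longleftrightarrow> set_mset x \<subseteq> A \<and> set_mset y \<subseteq> A \<and>
    multiset_product G x = multiset_product G y" for x y
  have rel_sym: "rel x y \<Longrightarrow> rel y x" for x y by (auto simp: rel_def)
  define D where "D d \<longleftrightarrow> (\<exists>x y. rel x y \<and> size x = size y + d \<and> 0 < d)" for d
  have "size x0 \<noteq> size y0" using lf ex by blast
  then have "\<exists>d. D d"
  proof (cases "size x0 < size y0")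
    case True
    then have "D (size y0 - size x0)"
      unfolding D_def using ex by (intro exI[of _ y0] exI[of _ x0]) (auto simp: rel_def)
    then show ?thesis ..
  next
    case False
    with \<open>size x0 \<noteq> size y0\<close> have "D (size x0 - size y0)"
      unfolding D_def using ex by (intro exI[of _ x0] exI[of _ y0]) (auto simp: rel_def)
    then show ?thesis ..
  qed
  define d where "d = (LEAST d. D d)"
  have "D d" unfolding d_def using \<open>\<exists>d. D d\<close> by (rule LeastI_ex)
  have min: "\<not> D k" if "k < d" for k
    using not_less_Least that unfolding d_def by blast
  obtain z0 w0 where zw0: "rel z0 w0" "size z0 = size w0 + d" and d: "0 < d"
    using \<open>D d\<close> unfolding D_def by blast
  \<comment> \<open>Cancelling the common part keeps the length difference \<open>d\<close> and
    makes the two sides disjoint.\<close>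
  define c where "c = z0 \<inter># w0"
  define z where "z = z0 - c"
  define w where "w = w0 - c"
  have z0: "z0 = c + z" and w0: "w0 = c + w"
    by (auto simp: z_def w_def c_def multiset_eq_iff)
  have sets: "set_mset c \<subseteq> A" "set_mset z \<subseteq> A" "set_mset w \<subseteq> A"
    using zw0(1) z0 w0 by (auto simp: rel_def)
  have size_zw: "size z = size w + d" using zw0(2) z0 w0 by simp
  have disj: "z \<inter># w = {#}"
    by (rule multiset_eqI) (simp add: z_def w_def c_def)
  have "multiset_product G c \<otimes> multiset_product G z = multiset_product G c \<otimes> multiset_product G w"
    using zw0(1) z0 w0 sets A unfolding rel_def by (metis multiset_product_union subset_trans)
  then have prod_zw: "multiset_product G z = multiset_product G w"
    using sets A by (meson l_cancel multiset_product_closed subset_trans)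
  have ordered: "x = y \<or> (z \<subseteq># x \<and> w \<subseteq># y)" if rel: "rel x y" and le: "size y \<le> size x" for x y
  proof -
    \<comment> \<open>Adding \<open>k\<close> copies of \<open>w\<close> to \<open>x\<close> and of
      \<open>z\<close> to \<open>y\<close> preserves the relation and leaves the length difference
      \<open>r < d\<close>. Minimality of \<open>d\<close> gives \<open>r = 0\<close>, and
      \<open>lf\<close> then makes the two sides equal.\<close>
    define k where "k = (size x - size y) div d"
    define r where "r = (size x - size y) mod d"
    have kr: "size x = size y + (k * d + r)" and "r < d"
      using le d by (simp_all add: k_def r_def)
    define x' where "x' = x + repeat_mset k w"
    define y' where "y' = y + repeat_mset k z"
    have rep: "set_mset (repeat_mset k w) \<subseteq> A" "set_mset (repeat_mset k z) \<subseteq> A"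
      using sets by (meson order_trans set_mset_repeat_mset_subset)+
    have "multiset_product G (repeat_mset k w) = multiset_product G (repeat_mset k z)"
      using sets A prod_zw by (intro multiset_product_repeat_cong) auto
    then have rel': "rel x' y'"
      using rel rep A unfolding rel_def x'_def y'_def
      by (auto simp: multiset_product_union subset_trans)
    have size': "size x' = size y' + r"
      unfolding x'_def y'_def using kr size_zw by (simp add: size_repeat_mset algebra_simps)
    have "r = 0"
    proof (rule ccontr)
      assume "r \<noteq> 0"
      then have "D r" unfolding D_def using rel' size' by auto
      then show False using min \<open>r < d\<close> by blast
    qed
    then have eq: "x + repeat_mset k w = y + repeat_mset k z"
      using lf rel' size' unfolding rel_def x'_def y'_def by simp
    show ?thesis
    proof (cases "k = 0")
      case True
      then show ?thesis using eq by simp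
    next
      case False
      \<comment> \<open>An atom of \<open>z\<close> does not occur in \<open>w\<close>, so its
        multiplicity in \<open>x\<close> is at least \<open>k\<close> times that in
        \<open>z\<close>; symmetrically for \<open>w\<close> and \<open>y\<close>.\<close>
      have cnt: "count x u + k * count w u = count y u + k * count z u" for u
        using arg_cong[OF eq, of "\<lambda>m. count m u"] by simp
      have dis: "count z u = 0 \<or> count w u = 0" for u
        using arg_cong[OF disj, of "\<lambda>m. count m u"] by (auto simp: min_def split: if_splits)
      have mul: "n \<le> k * n" for n using False by simp
      have "count z u \<le> count x u \<and> count w u \<le> count y u" for u
      proof -
        have "(count z u = 0 \<and> k * count z u = 0) \<or> (count w u = 0 \<and> k * count w u = 0)"
          using dis[of u] by auto
        then show ?thesis
          using cnt[of u] mul[of "count z u"] mul[of "count w u"] by linarith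
      qed
      then show ?thesis by (simp add: subseteq_mset_def)
    qed
  qed
  show ?thesis
  proof (rule that[OF sets(2,3) prod_zw _ disj])
    show "size w < size z" using size_zw d by simp
    fix x y
    assume "set_mset x \<subseteq> A" "set_mset y \<subseteq> A" "multiset_product G x = multiset_product G y"
    then have "rel x y" by (simp add: rel_def)
    then show "x = y \<or> (z \<subseteq># x \<and> w \<subseteq># y) \<or> (z \<subseteq># y \<and> w \<subseteq># x)"
      using ordered[of x y] ordered[of y x] rel_sym by (metis nat_le_linear)
  qed
qed

lemma (in comm_monoid_cancel) atom_divides_atom:
  assumes red: "Units G = {\<one>}" and "a \<in> atoms G" "b \<in> atoms G" "a divides b"
  shows "a = b"
proof -
  obtain c where c: "c \<in> carrier G" "b = a \<otimes> c" using assms(4) by (auto simp: factor_def)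
  then have "c \<in> Units G" using assms(2,3) unfolding atoms_def by blast
  then show ?thesis using c red assms(2) atoms_subset[of G] by auto
qed

lemma (in comm_monoid_cancel) unique_factorization_if_length_factorial:
  assumes red: "Units G = {\<one>}" and exch: "exchange G"
    and ex: "\<And>a. a \<in> carrier G \<Longrightarrow> \<exists>x. set_mset x \<subseteq> atoms G \<and> multiset_product G x = a"
    and lf: "\<And>x y. \<lbrakk>set_mset x \<subseteq> atoms G; set_mset y \<subseteq> atoms G;
      multiset_product G x = multiset_product G y; size x = size y\<rbrakk> \<Longrightarrow> x = y"
    and xy: "set_mset x \<subseteq> atoms G" "set_mset y \<subseteq> atoms G" "multiset_product G x = multiset_product G y"
  shows "x = y"
proof (rule ccontr)
  assume "x \<noteq> y"
  note A = atoms_subset[of G]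
  obtain z w where zw: "set_mset z \<subseteq> atoms G" "set_mset w \<subseteq> atoms G"
      "multiset_product G z = multiset_product G w" "size w < size z" "z \<inter># w = {#}"
    and rel: "\<And>x y. \<lbrakk>set_mset x \<subseteq> atoms G; set_mset y \<subseteq> atoms G;
       multiset_product G x = multiset_product G y\<rbrakk> \<Longrightarrow>
       x = y \<or> (z \<subseteq># x \<and> w \<subseteq># y) \<or> (z \<subseteq># y \<and> w \<subseteq># x)"
  proof -
    show thesis
      by (rule master_relation[OF _ A xy \<open>x \<noteq> y\<close>], erule (3) lf) (fact that)
  qed
  have "z \<noteq> {#}" using zw(4) by auto
  then obtain a z' where z: "z = add_mset a z'" by (metis multiset_cases)
  have a: "a \<in> atoms G" "a \<in> carrier G" and z': "set_mset z' \<subseteq> atoms G"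
    using zw(1) z A by auto
  have prod_z: "multiset_product G z = a \<otimes> multiset_product G z'"
    using z a z' A by (auto simp: multiset_product_add_mset)
  have "w \<noteq> {#}"
  proof
    assume "w = {#}"
    then have "a \<otimes> multiset_product G z' = \<one>" using zw(3) prod_z by simp
    moreover have "multiset_product G z' \<in> carrier G"
      using z' A by (auto intro: multiset_product_closed)
    ultimately have "a \<in> Units G" using a(2) unit_factor[of a "multiset_product G z'"] by simp
    then show False using a(1) by (simp add: atoms_def)
  qed
  then obtain b w' where w: "w = add_mset b w'" by (metis multiset_cases)
  have b: "b \<in> atoms G" "b \<in> carrier G" and w': "set_mset w' \<subseteq> atoms G"
    using zw(2) w A by auto
  have prod_w: "multiset_product G w = b \<otimes> multiset_product G w'"
    using w b w' A by (auto simp: multiset_product_add_mset)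
  have disj: "u \<in># z \<Longrightarrow> u \<notin># w" for u
    using zw(5) by (metis disjunct_not_in)
  \<comment> \<open>Disjointness makes \<open>a\<close> and \<open>b\<close> distinct atoms; as
    \<open>\<one>\<close> is the only unit, neither divides the other and \<open>exchange\<close>
    applies.\<close>
  have "a \<noteq> b" using disj[of a] z w by auto
  then have "\<not> a divides b" "\<not> b divides a"
    using atom_divides_atom[OF red] a b by blast+
  moreover have "multiset_product G z' \<in> carrier G" "multiset_product G w' \<in> carrier G"
    using z' w' A by (auto intro: multiset_product_closed)
  moreover have "a \<otimes> multiset_product G z' = b \<otimes> multiset_product G w'"
    using zw(3) prod_z prod_w by simp
  ultimately obtain c e where ce: "c \<in> carrier G" "e \<in> carrier G"
      "a \<otimes> c = multiset_product G w' \<otimes> e" "\<not> a divides e" "\<not> b divides e"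
    using exchangeE[OF exch] a(2) b(2) by metis
  obtain fc fe where fc: "set_mset fc \<subseteq> atoms G" "multiset_product G fc = c"
    and fe: "set_mset fe \<subseteq> atoms G" "multiset_product G fe = e"
    using ex ce(1,2) by meson
  have a_fe: "a \<notin># fe" and b_fe: "b \<notin># fe"
    using member_divides_multiset_product[of fe] fe A ce(4,5) by auto
  have "multiset_product G (add_mset a fc) = multiset_product G (w' + fe)"
    using ce(3) fc fe a w' A multiset_product_add_mset[of a fc] multiset_product_union[of w' fe] by auto
  \<comment> \<open>All three cases fail. The first and the third would put \<open>a\<close> into
    \<open>w' + fe\<close>, but \<open>a\<close> occurs neither in \<open>w\<close> nor in
    \<open>fe\<close>. The second would need one more copy of \<open>b\<close> than
    \<open>w'\<close> has, and \<open>fe\<close> contains none.\<close>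
  then have "add_mset a fc = w' + fe \<or> (z \<subseteq># add_mset a fc \<and> w \<subseteq># w' + fe) \<or>
      (z \<subseteq># w' + fe \<and> w \<subseteq># add_mset a fc)"
    using rel[of "add_mset a fc" "w' + fe"] a fc fe w' by simp
  moreover have "a \<notin># w' + fe" using a_fe disj[of a] z w by auto
  moreover have "\<not> w \<subseteq># w' + fe"
    using b_fe unfolding w by (simp add: subseteq_mset_def)
  moreover have "a \<in># z" "a \<in># add_mset a fc" using z by simp_all
  ultimately show False
    using mset_subset_eqD by fastforce
qed

section \<open>Reduced monoids\<close>

text \<open>Common setting of both cases: for commutative monoids the unit is \<open>\<one>\<close>,
  for normalizing Krull rings it measures the failure of \<open>a\<close> and \<open>b\<close> to
  commute. The condition makes the cosets of the unit group a commutative cancellative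
  monoid.\<close>

locale comm_up_to_units = monoid_cancel +
  assumes m_comm_unit: "\<lbrakk>a \<in> carrier G; b \<in> carrier G\<rbrakk> \<Longrightarrow> \<exists>u \<in> Units G. a \<otimes> b = b \<otimes> a \<otimes> u"
begin

text \<open>Moving units to the right is what makes the set product of two left cosets a single left
  coset.\<close>

lemma unit_swap:
  assumes "u \<in> Units G" "a \<in> carrier G"
  obtains v where "v \<in> Units G" "u \<otimes> a = a \<otimes> v"
proof -
  obtain w where w: "w \<in> Units G" "u \<otimes> a = a \<otimes> u \<otimes> w"
    using m_comm_unit assms by blast
  show ?thesis
    by (rule that[of "u \<otimes> w"]) (use w assms in \<open>auto simp: m_assoc Units_closed\<close>)
qed

lemma unit_coset_eq_iff:
  assumes "a \<in> carrier G" "b \<in> carrier G"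
  shows "a <# Units G = b <# Units G \<longleftrightarrow> (\<exists>u \<in> Units G. a = b \<otimes> u)"
proof
  assume "a <# Units G = b <# Units G"
  moreover have "a \<in> a <# Units G"
    unfolding l_coset_def using assms r_one by (metis Units_one_closed UN_I singletonI)
  ultimately show "\<exists>u \<in> Units G. a = b \<otimes> u" by (auto simp: l_coset_def)
next
  assume "\<exists>u \<in> Units G. a = b \<otimes> u"
  then obtain u where u: "u \<in> Units G" "a = b \<otimes> u" by blast
  have "x \<in> a <# Units G" if x: "x \<in> b <# Units G" for x
  proof -
    obtain v where v: "v \<in> Units G" "x = b \<otimes> v" using x by (auto simp: l_coset_def)
    have "b \<otimes> v = b \<otimes> u \<otimes> (inv u \<otimes> v)"
    proof -
      have "u \<otimes> (inv u \<otimes> v) = v"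
        using u v by (simp add: m_assoc[symmetric] Units_closed)
      then show ?thesis using u v assms by (simp add: m_assoc Units_closed)
    qed
    then show ?thesis using u v by (auto simp: l_coset_def)
  qed
  moreover have "x \<in> b <# Units G" if "x \<in> a <# Units G" for x
    using that u assms by (auto simp: l_coset_def m_assoc Units_closed)
  ultimately show "a <# Units G = b <# Units G" by blast
qed

lemma unit_coset_eqD:
  assumes "a <# Units G = b <# Units G" "a \<in> carrier G" "b \<in> carrier G"
  obtains u where "u \<in> Units G" "a = b \<otimes> u"
  using unit_coset_eq_iff assms by blast

lemma unit_coset_eqI:
  "\<lbrakk>b \<in> carrier G; u \<in> Units G; a = b \<otimes> u\<rbrakk> \<Longrightarrow> a <# Units G = b <# Units G"
  using unit_coset_eq_iff[of a b] by (auto simp: Units_closed)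

lemma unit_coset_mult:
  assumes "a \<in> carrier G" "b \<in> carrier G"
  shows "(a <# Units G) <#> (b <# Units G) = (a \<otimes> b) <# Units G"
proof -
  have "a \<otimes> u \<otimes> (b \<otimes> v) \<in> (a \<otimes> b) <# Units G" if uv: "u \<in> Units G" "v \<in> Units G" for u v
  proof -
    obtain w where w: "w \<in> Units G" "u \<otimes> b = b \<otimes> w" using unit_swap uv(1) assms(2) .
    have "a \<otimes> u \<otimes> (b \<otimes> v) = a \<otimes> (u \<otimes> b) \<otimes> v"
      using uv assms by (simp add: m_assoc Units_closed)
    also have "\<dots> = a \<otimes> b \<otimes> (w \<otimes> v)"
      using uv w assms by (simp add: m_assoc Units_closed)
    finally show ?thesis using uv w by (auto simp: l_coset_def)
  qed
  moreover have "a \<otimes> b \<otimes> v \<in> (a <# Units G) <#> (b <# Units G)" if "v \<in> Units G" for v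
  proof -
    have "a \<otimes> b \<otimes> v = a \<otimes> \<one> \<otimes> (b \<otimes> v)"
      using that assms by (simp add: m_assoc Units_closed)
    then show ?thesis using that by (auto simp: l_coset_def set_mult_def)
  qed
  ultimately have "(\<forall>u\<in>Units G. \<forall>v\<in>Units G. a \<otimes> u \<otimes> (b \<otimes> v) \<in> (a \<otimes> b) <# Units G) \<and>
      (\<forall>v\<in>Units G. a \<otimes> b \<otimes> v \<in> (a <# Units G) <#> (b <# Units G))"
    by blast
  then show ?thesis
    unfolding set_mult_def l_coset_def[of _ a] l_coset_def[of _ b] l_coset_def[of _ "a \<otimes> b"] by blast
qed

lemma unit_coset_one: "\<one> <# Units G = Units G"
  by (auto simp: l_coset_def Units_closed)

lemma carrier_reduced: "carrier (reduced_monoid G) = (\<lambda>a. a <# Units G) ` carrier G"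
  by (auto simp: reduced_monoid_def)

lemma one_reduced: "\<one>\<^bsub>reduced_monoid G\<^esub> = \<one> <# Units G"
  by (simp add: reduced_monoid_def unit_coset_one)

lemma mult_reduced:
  "\<lbrakk>a \<in> carrier G; b \<in> carrier G\<rbrakk> \<Longrightarrow>
     (a <# Units G) \<otimes>\<^bsub>reduced_monoid G\<^esub> (b <# Units G) = (a \<otimes> b) <# Units G"
  by (simp add: reduced_monoid_def unit_coset_mult)

lemma reduced_comm_monoid_cancel: "comm_monoid_cancel (reduced_monoid G)"
proof (rule comm_monoid_cancelI)
  have comm: "(a \<otimes> b) <# Units G = (b \<otimes> a) <# Units G" if "a \<in> carrier G" "b \<in> carrier G" for a b
    using m_comm_unit[OF that] that unit_coset_eqI by blast
  show "comm_monoid (reduced_monoid G)"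
    by (rule comm_monoidI)
      (auto simp: carrier_reduced one_reduced mult_reduced m_assoc comm)
  fix x y z
  assume *: "x \<otimes>\<^bsub>reduced_monoid G\<^esub> z = y \<otimes>\<^bsub>reduced_monoid G\<^esub> z"
    and xyz: "x \<in> carrier (reduced_monoid G)" "y \<in> carrier (reduced_monoid G)"
      "z \<in> carrier (reduced_monoid G)"
  obtain a b c where abc: "a \<in> carrier G" "b \<in> carrier G" "c \<in> carrier G"
      and eqs: "x = a <# Units G" "y = b <# Units G" "z = c <# Units G"
    using xyz by (auto simp: carrier_reduced)
  have "(c \<otimes> a) <# Units G = (c \<otimes> b) <# Units G"
    using * abc eqs comm by (simp add: mult_reduced)
  then obtain u where u: "u \<in> Units G" "c \<otimes> a = c \<otimes> b \<otimes> u"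
    using unit_coset_eqD abc by (metis m_closed)
  then have "c \<otimes> a = c \<otimes> (b \<otimes> u)" using abc by (simp add: m_assoc Units_closed)
  then have "a = b \<otimes> u" using l_cancel[of c a "b \<otimes> u"] u(1) abc by (simp add: Units_closed)
  then show "x = y" unfolding eqs using u(1) abc(2) by (intro unit_coset_eqI)
qed

text \<open>If the cosets of \<open>a\<close> and \<open>b\<close> are mutually inverse, both
  \<open>a \<otimes> b\<close> and \<open>b \<otimes> a\<close> are units of \<open>G\<close>. This
  gives \<open>a\<close> a right and a left inverse, which coincide.\<close>

lemma Units_reduced: "Units (reduced_monoid G) = {\<one>\<^bsub>reduced_monoid G\<^esub>}"
proof -
  interpret M: comm_monoid_cancel "reduced_monoid G" by (rule reduced_comm_monoid_cancel)
  have "x = \<one>\<^bsub>reduced_monoid G\<^esub>" if x: "x \<in> Units (reduced_monoid G)" for x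
  proof -
    obtain y where "x \<in> carrier (reduced_monoid G)" "y \<in> carrier (reduced_monoid G)"
        "x \<otimes>\<^bsub>reduced_monoid G\<^esub> y = \<one>\<^bsub>reduced_monoid G\<^esub>"
        "y \<otimes>\<^bsub>reduced_monoid G\<^esub> x = \<one>\<^bsub>reduced_monoid G\<^esub>"
      using x unfolding Units_def by blast
    then obtain a b where ab: "a \<in> carrier G" "b \<in> carrier G" "x = a <# Units G"
        "(a \<otimes> b) <# Units G = \<one> <# Units G" "(b \<otimes> a) <# Units G = \<one> <# Units G"
      by (auto simp: carrier_reduced mult_reduced one_reduced)
    then have "a \<otimes> b \<in> Units G" "b \<otimes> a \<in> Units G"
      by (metis unit_coset_eqD Units_closed l_one m_closed one_closed)+
    then obtain c d where "c \<in> carrier G" "d \<in> carrier G" "a \<otimes> b \<otimes> c = \<one>" "d \<otimes> (b \<otimes> a) = \<one>"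
      unfolding Units_def by blast
    then have "a \<otimes> (b \<otimes> c) = \<one>" "(d \<otimes> b) \<otimes> a = \<one>" using ab by (simp_all add: m_assoc)
    moreover have "b \<otimes> c \<in> carrier G" "d \<otimes> b \<in> carrier G"
      using ab \<open>c \<in> carrier G\<close> \<open>d \<in> carrier G\<close> by auto
    ultimately have "a \<in> Units G"
      using ab(1) inv_unique[of "d \<otimes> b" a "b \<otimes> c"] unfolding Units_def by auto
    then show ?thesis
      unfolding ab(3) one_reduced by (intro unit_coset_eqI[of \<one> a]) (use ab in auto)
  qed
  then show ?thesis by blast
qed

lemma divides_reduced_iff:
  assumes "a \<in> carrier G" "b \<in> carrier G"
  shows "(a <# Units G) divides\<^bsub>reduced_monoid G\<^esub> (b <# Units G) \<longleftrightarrow> a divides b"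
proof
  assume "(a <# Units G) divides\<^bsub>reduced_monoid G\<^esub> (b <# Units G)"
  then obtain c where c: "c \<in> carrier G" "b <# Units G = (a \<otimes> c) <# Units G"
    using assms by (auto simp: factor_def carrier_reduced mult_reduced)
  then obtain u where "u \<in> Units G" "b = a \<otimes> c \<otimes> u"
    using assms unit_coset_eqD by (metis m_closed)
  then have "b = a \<otimes> (c \<otimes> u)" "c \<otimes> u \<in> carrier G"
    using assms c by (auto simp: m_assoc Units_closed)
  then show "a divides b" by (auto simp: factor_def)
next
  assume "a divides b"
  then show "(a <# Units G) divides\<^bsub>reduced_monoid G\<^esub> (b <# Units G)"
    using assms by (auto simp: factor_def carrier_reduced mult_reduced)
qed

text \<open>Divisibility does not see units, so representatives may be used. The unit
  \<open>u\<close> between the two products is absorbed into \<open>w\<close> before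
  \<open>exchange\<close> is applied, and is moved past \<open>y\<close> afterwards.\<close>

lemma exchange_reduced:
  assumes "exchange G"
  shows "exchange (reduced_monoid G)"
  unfolding exchange_def
proof (intro ballI impI, elim conjE)
  let ?M = "reduced_monoid G" and ?U = "Units G"
  fix A B Z W
  assume carr: "A \<in> carrier ?M" "B \<in> carrier ?M" "Z \<in> carrier ?M" "W \<in> carrier ?M"
    and eq: "A \<otimes>\<^bsub>?M\<^esub> Z = B \<otimes>\<^bsub>?M\<^esub> W"
    and ndvd: "\<not> A divides\<^bsub>?M\<^esub> B" "\<not> B divides\<^bsub>?M\<^esub> A"
  obtain a b z w where abzw: "a \<in> carrier G" "b \<in> carrier G" "z \<in> carrier G" "w \<in> carrier G"
      and eqs: "A = a <# ?U" "B = b <# ?U" "Z = z <# ?U" "W = w <# ?U"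
    using carr by (auto simp: carrier_reduced)
  obtain u where u: "u \<in> ?U" "a \<otimes> z = b \<otimes> w \<otimes> u"
    using eq abzw unit_coset_eqD[of "a \<otimes> z" "b \<otimes> w"] unfolding eqs by (auto simp: mult_reduced)
  have "a \<otimes> z = b \<otimes> (w \<otimes> u)" "w \<otimes> u \<in> carrier G"
    using u abzw by (auto simp: m_assoc Units_closed)
  moreover have "\<not> a divides b" "\<not> b divides a"
    using ndvd abzw eqs by (auto simp: divides_reduced_iff)
  ultimately obtain x y where xy: "x \<in> carrier G" "y \<in> carrier G" "a \<otimes> x = w \<otimes> u \<otimes> y"
      "\<not> a divides y" "\<not> b divides y"
    using exchangeE[OF assms] abzw by metis
  obtain v where "v \<in> ?U" "u \<otimes> y = y \<otimes> v"
    using unit_swap u(1) xy(2) .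
  then have "a \<otimes> x = w \<otimes> y \<otimes> v" "v \<in> ?U"
    using xy abzw u by (auto simp: m_assoc Units_closed)
  then have "(a \<otimes> x) <# ?U = (w \<otimes> y) <# ?U"
    using abzw xy(2) by (intro unit_coset_eqI) auto
  then have "A \<otimes>\<^bsub>?M\<^esub> (x <# ?U) = W \<otimes>\<^bsub>?M\<^esub> (y <# ?U)"
    using abzw xy(1,2) eqs by (simp add: mult_reduced)
  moreover have "\<not> A divides\<^bsub>?M\<^esub> (y <# ?U)" "\<not> B divides\<^bsub>?M\<^esub> (y <# ?U)"
    using abzw xy eqs by (auto simp: divides_reduced_iff)
  moreover have "x <# ?U \<in> carrier ?M" "y <# ?U \<in> carrier ?M"
    using xy(1,2) by (auto simp: carrier_reduced)
  ultimately show "\<exists>x\<in>carrier ?M. \<exists>y\<in>carrier ?M. A \<otimes>\<^bsub>?M\<^esub> x = W \<otimes>\<^bsub>?M\<^esub> y \<and>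
      \<not> A divides\<^bsub>?M\<^esub> y \<and> \<not> B divides\<^bsub>?M\<^esub> y"
    by blast
qed

text \<open>Factorizations are multisets of atoms of the reduced monoid and every element there is a
  coset, so the hypothesis on the elements of \<open>G\<close> becomes one on the products of such
  multisets.\<close>

lemma length_factorial_iff_factorial:
  assumes "exchange G"
  shows "length_factorial G \<longleftrightarrow> factorial G"
proof
  assume lf: "length_factorial G"
  let ?M = "reduced_monoid G"
  interpret M: comm_monoid_cancel ?M by (rule reduced_comm_monoid_cancel)
  have fac: "x \<in> factorizations G a \<longleftrightarrow>
      set_mset x \<subseteq> atoms ?M \<and> multiset_product ?M x = a <# Units G" for x a
    by (simp add: factorizations_def)
  have nonempty: "factorizations G a \<noteq> {}" if "a \<in> carrier G" for a
    using lf that by (simp add: length_factorial_def atomic_def)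
  have ex: "\<exists>x. set_mset x \<subseteq> atoms ?M \<and> multiset_product ?M x = c" if "c \<in> carrier ?M" for c
    using that nonempty by (auto simp: carrier_reduced ex_in_conv[symmetric] fac)
  have unique: "x = y"
    if xy: "set_mset x \<subseteq> atoms ?M" "set_mset y \<subseteq> atoms ?M"
       "multiset_product ?M x = multiset_product ?M y" "size x = size y" for x y
  proof -
    have "multiset_product ?M x \<in> carrier ?M"
      by (rule M.multiset_product_closed[OF subset_trans[OF xy(1) atoms_subset]])
    then obtain a where a: "a \<in> carrier G" "multiset_product ?M x = a <# Units G"
      by (auto simp: carrier_reduced)
    then have "x \<in> factorizations G a" "y \<in> factorizations G a" using xy by (simp_all add: fac)
    then show ?thesis using lf a(1) xy(4) unfolding length_factorial_def by blast
  qed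
  have "x = y" if "x \<in> factorizations G a" "y \<in> factorizations G a" for x y a
  proof (rule M.unique_factorization_if_length_factorial[OF Units_reduced exchange_reduced[OF assms]])
    show "set_mset x \<subseteq> atoms ?M" "set_mset y \<subseteq> atoms ?M"
        "multiset_product ?M x = multiset_product ?M y"
      using that by (simp_all add: fac)
  qed (fact ex unique)+
  then show "factorial G"
    using nonempty unfolding factorial_def by blast
qed (rule factorial_imp_length_factorial)

end

lemma (in comm_monoid_cancel) is_comm_up_to_units: "comm_up_to_units G"
  by unfold_locales (metis m_comm Units_one_closed m_closed r_one)

section \<open>Commutativity up to units in normalizing maximal orders\<close>

text \<open>This is \<open>x I = I x\<close> for nonzero \<open>x\<close>, in elementwise form.
  \<open>I\<close> is an arbitrary set because the notion is needed for \<open>R\<close>, for a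
  prime ideal \<open>P\<close> and for the complement \<open>R - P\<close>.\<close>

definition normalizes :: "('a, 'm) ring_scheme \<Rightarrow> 'a set \<Rightarrow> 'a \<Rightarrow> bool" where
  "normalizes Q I x \<longleftrightarrow> x \<in> carrier Q \<and> x \<noteq> \<zero>\<^bsub>Q\<^esub> \<and>
     (\<forall>r \<in> I. (\<exists>r' \<in> I. x \<otimes>\<^bsub>Q\<^esub> r = r' \<otimes>\<^bsub>Q\<^esub> x) \<and> (\<exists>r' \<in> I. r \<otimes>\<^bsub>Q\<^esub> x = x \<otimes>\<^bsub>Q\<^esub> r'))"

text \<open>Nonzero two-sided ideals of a subring \<open>R\<close> of \<open>Q\<close>; closure
  under negatives comes from multiplication by \<open>\<ominus> \<one>\<close>.\<close>

definition nonzero_twosided :: "('a, 'm) ring_scheme \<Rightarrow> 'a set \<Rightarrow> 'a set \<Rightarrow> bool" where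
  "nonzero_twosided Q R I \<longleftrightarrow> I \<subseteq> R \<and> (\<exists>x \<in> I. x \<noteq> \<zero>\<^bsub>Q\<^esub>) \<and>
     (\<forall>x \<in> I. \<forall>y \<in> I. x \<oplus>\<^bsub>Q\<^esub> y \<in> I) \<and>
     (\<forall>x \<in> I. \<forall>r \<in> R. r \<otimes>\<^bsub>Q\<^esub> x \<in> I \<and> x \<otimes>\<^bsub>Q\<^esub> r \<in> I)"

text \<open>For \<open>c\<close> in a ring \<open>Q\<close> with subring \<open>R\<close>, this
  contains \<open>\<one>\<close> exactly if \<open>c \<in> R\<close>; so elements outside
  \<open>R\<close> have proper ideals of denominators.\<close>

definition denominators :: "('a, 'm) ring_scheme \<Rightarrow> 'a set \<Rightarrow> 'a \<Rightarrow> 'a set" where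
  "denominators Q R c = {r \<in> R. c \<otimes>\<^bsub>Q\<^esub> r \<in> R}"

section \<open>Normalizing elements of a division ring\<close>

locale division_ring = ring Q for Q (structure) +
  assumes one_neq_zero: "\<one> \<noteq> \<zero>"
    and nonzero_Units: "\<lbrakk>x \<in> carrier Q; x \<noteq> \<zero>\<rbrakk> \<Longrightarrow> x \<in> Units Q"
begin

lemma inv_nonzero:
  assumes "x \<in> carrier Q" "x \<noteq> \<zero>"
  shows "inv x \<in> carrier Q" "inv x \<noteq> \<zero>" "inv x \<otimes> x = \<one>" "x \<otimes> inv x = \<one>"
proof -
  have u: "x \<in> Units Q" using assms nonzero_Units by blast
  then show "inv x \<in> carrier Q" "inv x \<otimes> x = \<one>" "x \<otimes> inv x = \<one>" by simp_all
  then show "inv x \<noteq> \<zero>" using one_neq_zero assms by (metis l_null)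
qed

lemma l_cancel_nonzero:
  "\<lbrakk>x \<in> carrier Q; x \<noteq> \<zero>; y \<in> carrier Q; z \<in> carrier Q; x \<otimes> y = x \<otimes> z\<rbrakk> \<Longrightarrow> y = z"
  using nonzero_Units Units_l_cancel by blast

lemma m_nonzero:
  assumes "x \<in> carrier Q" "y \<in> carrier Q" "x \<noteq> \<zero>" "y \<noteq> \<zero>"
  shows "x \<otimes> y \<noteq> \<zero>"
  using assms l_cancel_nonzero[of x y \<zero>] by auto

lemma r_cancel_nonzero:
  assumes "x \<in> carrier Q" "x \<noteq> \<zero>" "y \<in> carrier Q" "z \<in> carrier Q" "y \<otimes> x = z \<otimes> x"
  shows "y = z"
proof -
  note ix = inv_nonzero[OF assms(1,2)]
  have "y \<otimes> (x \<otimes> inv x) = z \<otimes> (x \<otimes> inv x)"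
    using assms ix(1) by (simp add: m_assoc[symmetric])
  then show ?thesis using assms ix(4) by simp
qed

lemma normalizesD:
  assumes "normalizes Q I x" "r \<in> I"
  obtains r' where "r' \<in> I" "x \<otimes> r = r' \<otimes> x"
  using assms unfolding normalizes_def by blast

lemma normalizesD':
  assumes "normalizes Q I x" "r \<in> I"
  obtains r' where "r' \<in> I" "r \<otimes> x = x \<otimes> r'"
  using assms unfolding normalizes_def by blast

lemma normalizes_one: "I \<subseteq> carrier Q \<Longrightarrow> normalizes Q I \<one>"
  using one_neq_zero unfolding normalizes_def by (auto simp: subset_eq)

lemma normalizes_mult:
  assumes "I \<subseteq> carrier Q" and x: "normalizes Q I x" and y: "normalizes Q I y"
  shows "normalizes Q I (x \<otimes> y)"
proof -
  have carr: "x \<in> carrier Q" "y \<in> carrier Q" "x \<noteq> \<zero>" "y \<noteq> \<zero>"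
    using x y by (auto simp: normalizes_def)
  have "(\<exists>r'\<in>I. x \<otimes> y \<otimes> r = r' \<otimes> (x \<otimes> y)) \<and> (\<exists>r'\<in>I. r \<otimes> (x \<otimes> y) = x \<otimes> y \<otimes> r')" if r: "r \<in> I" for r
  proof
    obtain r1 where r1: "r1 \<in> I" "y \<otimes> r = r1 \<otimes> y" by (rule normalizesD[OF y r])
    obtain r2 where r2: "r2 \<in> I" "x \<otimes> r1 = r2 \<otimes> x" by (rule normalizesD[OF x r1(1)])
    have in_Q: "r \<in> carrier Q" "r1 \<in> carrier Q" "r2 \<in> carrier Q" using r r1 r2 assms(1) by auto
    have "x \<otimes> y \<otimes> r = x \<otimes> r1 \<otimes> y" using r1 carr in_Q by (simp add: m_assoc)
    then show "\<exists>r'\<in>I. x \<otimes> y \<otimes> r = r' \<otimes> (x \<otimes> y)"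
      using r2 carr in_Q by (auto simp: m_assoc)
    obtain r3 where r3: "r3 \<in> I" "r \<otimes> x = x \<otimes> r3" by (rule normalizesD'[OF x r])
    obtain r4 where r4: "r4 \<in> I" "r3 \<otimes> y = y \<otimes> r4" by (rule normalizesD'[OF y r3(1)])
    have in_Q': "r3 \<in> carrier Q" "r4 \<in> carrier Q" using r3 r4 assms(1) by auto
    have "r \<otimes> (x \<otimes> y) = x \<otimes> r3 \<otimes> y" using r3 carr in_Q by (simp add: m_assoc[symmetric])
    also have "\<dots> = x \<otimes> y \<otimes> r4" using r4 carr in_Q' by (simp add: m_assoc)
    finally show "\<exists>r'\<in>I. r \<otimes> (x \<otimes> y) = x \<otimes> y \<otimes> r'"
      using r4 by blast
  qed
  then show ?thesis using carr m_nonzero by (simp add: normalizes_def)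
qed

lemma normalizes_inv:
  assumes "I \<subseteq> carrier Q" and x: "normalizes Q I x"
  shows "normalizes Q I (inv x)"
proof -
  have carr: "x \<in> carrier Q" "x \<noteq> \<zero>"
    using x by (auto simp: normalizes_def)
  note ix = inv_nonzero[OF carr]
  have "(\<exists>r'\<in>I. inv x \<otimes> r = r' \<otimes> inv x) \<and> (\<exists>r'\<in>I. r \<otimes> inv x = inv x \<otimes> r')" if r: "r \<in> I" for r
  proof
    obtain r1 where r1: "r1 \<in> I" "r \<otimes> x = x \<otimes> r1" by (rule normalizesD'[OF x r])
    obtain r2 where r2: "r2 \<in> I" "x \<otimes> r = r2 \<otimes> x" by (rule normalizesD[OF x r])
    have in_Q: "r \<in> carrier Q" "r1 \<in> carrier Q" "r2 \<in> carrier Q" using r r1 r2 assms(1) by auto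
    have "inv x \<otimes> r = inv x \<otimes> (r \<otimes> x) \<otimes> inv x" using ix carr in_Q by (simp add: m_assoc)
    also have "\<dots> = r1 \<otimes> inv x"
      unfolding r1(2) using ix carr in_Q by (simp add: m_assoc[symmetric])
    finally show "\<exists>r'\<in>I. inv x \<otimes> r = r' \<otimes> inv x" using r1 by blast
    have "r \<otimes> inv x = inv x \<otimes> (x \<otimes> r) \<otimes> inv x" using ix carr in_Q by (simp add: m_assoc[symmetric])
    also have "\<dots> = inv x \<otimes> r2"
      unfolding r2(2) using ix carr in_Q by (simp add: m_assoc)
    finally show "\<exists>r'\<in>I. r \<otimes> inv x = inv x \<otimes> r'" using r2 by blast
  qed
  then show ?thesis using ix by (simp add: normalizes_def)
qed

lemma normalizes_pow:
  "\<lbrakk>I \<subseteq> carrier Q; normalizes Q I x\<rbrakk> \<Longrightarrow> normalizes Q I (x [^] (n::nat))"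
  by (induction n) (auto intro: normalizes_one normalizes_mult)

text \<open>Conjugation by \<open>x\<close> preserves \<open>I\<close> and maps \<open>P\<close>
  onto itself. If it sent an element of \<open>I - P\<close> into \<open>P\<close>, conjugating back
  and cancelling \<open>x\<close> would put that element into \<open>P\<close>.\<close>

lemma normalizes_Diff:
  assumes "I \<subseteq> carrier Q" "P \<subseteq> I" and xI: "normalizes Q I x" and xP: "normalizes Q P x"
  shows "normalizes Q (I - P) x"
proof -
  have carr: "x \<in> carrier Q" "x \<noteq> \<zero>"
    using xI by (auto simp: normalizes_def)
  have "(\<exists>r'\<in>I - P. x \<otimes> r = r' \<otimes> x) \<and> (\<exists>r'\<in>I - P. r \<otimes> x = x \<otimes> r')" if r: "r \<in> I - P" for r
  proof
    obtain r1 where r1: "r1 \<in> I" "x \<otimes> r = r1 \<otimes> x" using normalizesD[OF xI] r by blast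
    have "r1 \<notin> P"
    proof
      assume "r1 \<in> P"
      then obtain r2 where "r2 \<in> P" "r1 \<otimes> x = x \<otimes> r2" by (rule normalizesD'[OF xP])
      then have "r = r2" using l_cancel_nonzero[OF carr] r r1 assms by auto
      then show False using r \<open>r2 \<in> P\<close> by blast
    qed
    then show "\<exists>r'\<in>I - P. x \<otimes> r = r' \<otimes> x" using r1 by blast
    obtain r3 where r3: "r3 \<in> I" "r \<otimes> x = x \<otimes> r3" using normalizesD'[OF xI] r by blast
    have "r3 \<notin> P"
    proof
      assume "r3 \<in> P"
      then obtain r4 where "r4 \<in> P" "x \<otimes> r3 = r4 \<otimes> x" by (rule normalizesD[OF xP])
      then have "r = r4" using r_cancel_nonzero[OF carr] r r3 assms by auto
      then show False using r \<open>r4 \<in> P\<close> by blast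
    qed
    then show "\<exists>r'\<in>I - P. r \<otimes> x = x \<otimes> r'" using r3 by blast
  qed
  then show ?thesis using carr by (simp add: normalizes_def)
qed

end

text \<open>\<open>R\<close> is a subset of its quotient division ring, so that no embedding has to
  be carried along. The chain condition is added later, as a hypothesis of
  \<open>commutes_up_to_factor\<close>.\<close>

locale normalizing_krull_order = division_ring +
  fixes R
  assumes subring: "subring R Q"
    and fraction: "x \<in> carrier Q \<Longrightarrow> \<exists>a \<in> R. \<exists>s \<in> R. s \<noteq> \<zero> \<and> x = a \<otimes> inv s"
    and normalizes_base: "\<lbrakk>a \<in> R; a \<noteq> \<zero>\<rbrakk> \<Longrightarrow> normalizes Q R a"
    and maximal_l: "\<lbrakk>nonzero_twosided Q R I; q \<in> carrier Q; \<And>x. x \<in> I \<Longrightarrow> q \<otimes> x \<in> I\<rbrakk> \<Longrightarrow> q \<in> R"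
    and maximal_r: "\<lbrakk>nonzero_twosided Q R I; q \<in> carrier Q; \<And>x. x \<in> I \<Longrightarrow> x \<otimes> q \<in> I\<rbrakk> \<Longrightarrow> q \<in> R"
begin

lemma R_carrier: "R \<subseteq> carrier Q"
  by (rule subringE(1)[OF subring])

lemmas R_simps [simp] =
  subringE(2,3,5-7)[OF subring]

lemma R_closed [simp]: "x \<in> R \<Longrightarrow> x \<in> carrier Q"
  using R_carrier by blast

text \<open>Every element of \<open>Q\<close> is a fraction, and normalizing elements are closed
  under products and inverses. Thus \<open>R\<close> is stable under all inner automorphisms of
  \<open>Q\<close>.\<close>

lemma normalizes_R:
  assumes "x \<in> carrier Q" "x \<noteq> \<zero>"
  shows "normalizes Q R x"
proof -
  obtain a s where as: "a \<in> R" "s \<in> R" "s \<noteq> \<zero>" "x = a \<otimes> inv s"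
    using fraction assms(1) by blast
  have "a \<noteq> \<zero>" using as assms inv_nonzero[of s] by auto
  then show ?thesis
    unfolding as(4) using as normalizes_base normalizes_inv normalizes_mult R_carrier by blast
qed

lemma swap_R:
  assumes "x \<in> carrier Q" "r \<in> R"
  obtains r' where "r' \<in> R" "x \<otimes> r = r' \<otimes> x"
proof (cases "x = \<zero>")
  case True
  then show ?thesis using that[of \<zero>] assms by simp
next
  case False
  then show ?thesis using that normalizesD[OF normalizes_R] assms by blast
qed

text \<open>The denominator \<open>s\<close> of \<open>c = a \<otimes> inv s\<close> is a nonzero
  member; left multiples stay inside because \<open>c \<otimes> r = r' \<otimes> c\<close> with
  \<open>r' \<in> R\<close>.\<close>

lemma denominators_twosided:
  assumes c: "c \<in> carrier Q"
  shows "nonzero_twosided Q R (denominators Q R c)"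
proof -
  obtain a s where as: "a \<in> R" "s \<in> R" "s \<noteq> \<zero>" "c = a \<otimes> inv s"
    using fraction c by blast
  have "c \<otimes> s = a" unfolding as(4) using as inv_nonzero[of s] by (simp add: m_assoc)
  then have "s \<in> denominators Q R c" using as by (simp add: denominators_def)
  moreover have "c \<otimes> (r \<otimes> x) \<in> R" if "r \<in> R" "x \<in> R" "c \<otimes> x \<in> R" for r x
  proof -
    obtain r' where r': "r' \<in> R" "c \<otimes> r = r' \<otimes> c" using swap_R c \<open>r \<in> R\<close> .
    have "c \<otimes> (r \<otimes> x) = r' \<otimes> (c \<otimes> x)" using r' that c by (simp add: m_assoc[symmetric])
    then show ?thesis using r' that by simp
  qed
  moreover have "c \<otimes> (x \<otimes> r) \<in> R" if "r \<in> R" "x \<in> R" "c \<otimes> x \<in> R" for r x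
    using that c by (simp add: m_assoc[symmetric])
  ultimately show ?thesis
    using as c unfolding nonzero_twosided_def denominators_def by (auto simp: r_distr)
qed

text \<open>Left and right inverses of an ideal agree: \<open>i \<otimes> q\<close> maps
  \<open>I\<close> into \<open>i R\<close>, hence into \<open>I\<close>, and a maximal order
  contains all such multipliers.\<close>

lemma multiplier_swap:
  assumes I: "nonzero_twosided Q R I" and q: "q \<in> carrier Q"
    and qI: "\<And>x. x \<in> I \<Longrightarrow> q \<otimes> x \<in> R" and i: "i \<in> I"
  shows "i \<otimes> q \<in> R"
proof (rule maximal_l[OF I])
  have sub: "I \<subseteq> R" using I by (simp add: nonzero_twosided_def)
  show "i \<otimes> q \<in> carrier Q" using sub i q by auto
  fix x assume x: "x \<in> I"
  have "i \<otimes> q \<otimes> x = i \<otimes> (q \<otimes> x)" using sub i q x by (intro m_assoc) auto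
  then show "i \<otimes> q \<otimes> x \<in> I" using I i qI[OF x] by (simp add: nonzero_twosided_def)
qed

lemma multiplier_swap':
  assumes I: "nonzero_twosided Q R I" and q: "q \<in> carrier Q"
    and qI: "\<And>x. x \<in> I \<Longrightarrow> x \<otimes> q \<in> R" and i: "i \<in> I"
  shows "q \<otimes> i \<in> R"
proof (rule maximal_r[OF I])
  have sub: "I \<subseteq> R" using I by (simp add: nonzero_twosided_def)
  show "q \<otimes> i \<in> carrier Q" using sub i q by auto
  fix x assume x: "x \<in> I"
  have "x \<otimes> (q \<otimes> i) = (x \<otimes> q) \<otimes> i" using sub i q x by (intro m_assoc[symmetric]) auto
  then show "x \<otimes> (q \<otimes> i) \<in> I" using I i qI[OF x] by (simp add: nonzero_twosided_def)
qed

text \<open>The right-hand side is the double inverse. The inverse contains \<open>\<one>\<close>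
  and \<open>c\<close>, so a member \<open>y\<close> of the double inverse satisfies
  \<open>y \<in> R\<close> and \<open>y \<otimes> c \<in> R\<close>. To bring \<open>c\<close> to
  the other side, \<open>multiplier_swap'\<close> is applied to the ideal of all \<open>x\<close>
  with \<open>x \<otimes> c \<in> R\<close>, which is nonzero if \<open>y\<close> is.\<close>

lemma denominators_divisorial:
  assumes c: "c \<in> carrier Q"
  shows "denominators Q R c =
    {y \<in> carrier Q. \<forall>q \<in> {q \<in> carrier Q. \<forall>x \<in> denominators Q R c. q \<otimes> x \<in> R}. y \<otimes> q \<in> R}"
    (is "?J = ?K")
proof
  show "?J \<subseteq> ?K"
    using multiplier_swap[OF denominators_twosided[OF c]] by (auto simp: denominators_def)
  show "?K \<subseteq> ?J"
  proof
    fix y assume y: "y \<in> ?K"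
    have "\<forall>x \<in> ?J. \<one> \<otimes> x \<in> R" "\<forall>x \<in> ?J. c \<otimes> x \<in> R"
      by (auto simp: denominators_def)
    then have "y \<otimes> \<one> \<in> R" "y \<otimes> c \<in> R" "y \<in> carrier Q" using y c by blast+
    then have yR: "y \<in> R" "y \<otimes> c \<in> R" by simp_all
    show "y \<in> ?J"
    proof (cases "y = \<zero>")
      case True
      then show ?thesis using c by (simp add: denominators_def)
    next
      case False
      let ?L = "{x \<in> R. x \<otimes> c \<in> R}"
      have "r \<otimes> x \<otimes> c \<in> R \<and> x \<otimes> r \<otimes> c \<in> R" if "r \<in> R" "x \<in> R" "x \<otimes> c \<in> R" for r x
      proof (cases "c = \<zero>")
        case False
        obtain r' where "r' \<in> R" "r \<otimes> c = c \<otimes> r'"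
          using normalizesD'[OF normalizes_R[OF c False] \<open>r \<in> R\<close>] by blast
        then have "x \<otimes> r \<otimes> c = x \<otimes> c \<otimes> r'" using that c by (simp add: m_assoc)
        then have "x \<otimes> r \<otimes> c \<in> R" using that \<open>r' \<in> R\<close> by simp
        then show ?thesis using that c by (simp add: m_assoc)
      qed (use that in simp)
      then have "nonzero_twosided Q R ?L"
        using yR False c unfolding nonzero_twosided_def by (auto simp: l_distr)
      then have "c \<otimes> y \<in> R" by (rule multiplier_swap') (use yR c in auto)
      then show ?thesis using yR by (simp add: denominators_def)
    qed
  qed
qed

end

text \<open>
  Let \<open>P\<close> be maximal among the proper ideals \<open>{r. q r \<in> R}\<close>. It is a prime ideal whose complement
  \<open>R - P\<close> is normalized by every nonzero element, and up to \<open>R - P\<close> every nonzero element of \<open>R\<close>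
  is a power of \<open>q\<close>. Hence commutators are units locally at \<open>P\<close>.
\<close>

locale maximal_denominators = normalizing_krull_order +
  fixes q P
  assumes q: "q \<in> carrier Q" "q \<notin> R"
    and P_def: "P = denominators Q R q"
    and P_maximal: "\<lbrakk>c \<in> carrier Q; c \<notin> R; P \<subseteq> denominators Q R c\<rbrakk> \<Longrightarrow> denominators Q R c = P"
begin

lemma P_twosided: "nonzero_twosided Q R P"
  unfolding P_def by (rule denominators_twosided[OF q(1)])

lemma P_iff: "x \<in> P \<longleftrightarrow> x \<in> R \<and> q \<otimes> x \<in> R"
  by (simp add: P_def denominators_def)

lemma P_subset: "P \<subseteq> R"
  using P_iff by blast

lemma q_P: "x \<in> P \<Longrightarrow> q \<otimes> x \<in> R"
  using P_iff by blast

lemma zero_in_P [simp]: "\<zero> \<in> P"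
  using q by (simp add: P_iff)

lemma minus_in_P: "x \<in> P \<Longrightarrow> \<ominus> x \<in> P"
  using q by (simp add: P_iff r_minus)

lemma P_in_R [simp]: "x \<in> P \<Longrightarrow> x \<in> R"
  using P_subset by blast

lemma P_carrier: "P \<subseteq> carrier Q"
  using P_subset R_carrier by blast

lemma P_simps [simp]:
  "\<lbrakk>x \<in> P; y \<in> P\<rbrakk> \<Longrightarrow> x \<oplus> y \<in> P"
  "\<lbrakk>x \<in> P; r \<in> R\<rbrakk> \<Longrightarrow> r \<otimes> x \<in> P"
  "\<lbrakk>x \<in> P; r \<in> R\<rbrakk> \<Longrightarrow> x \<otimes> r \<in> P"
  using P_twosided by (auto simp: nonzero_twosided_def)

lemma P_q: "x \<in> P \<Longrightarrow> x \<otimes> q \<in> R"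
  using multiplier_swap[OF P_twosided q(1) q_P] .

lemma q_nonzero: "q \<noteq> \<zero>"
  using q by auto

text \<open>\<open>x \<notin> P\<close> means \<open>q \<otimes> x \<notin> R\<close>. The
  denominators of \<open>q \<otimes> x\<close> contain \<open>P\<close>, hence equal
  \<open>P\<close> by maximality, and \<open>y\<close> is one of them.\<close>

lemma prime:
  assumes xy: "x \<in> R" "y \<in> R" "x \<otimes> y \<in> P" and "x \<notin> P"
  shows "y \<in> P"
proof -
  have qx: "q \<otimes> x \<in> carrier Q" "q \<otimes> x \<notin> R"
    using assms q unfolding P_iff by auto
  have "q \<otimes> x \<otimes> r \<in> R" if "r \<in> P" for r
    using that q xy q_P[of "x \<otimes> r"] by (simp add: m_assoc)
  then have "P \<subseteq> denominators Q R (q \<otimes> x)"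
    by (auto simp: denominators_def)
  then have "denominators Q R (q \<otimes> x) = P" using P_maximal qx by blast
  moreover have "y \<in> denominators Q R (q \<otimes> x)"
    using q xy q_P[of "x \<otimes> y"] by (simp add: denominators_def m_assoc)
  ultimately show ?thesis by simp
qed

text \<open>A maximal order forbids \<open>q P \<subseteq> P\<close> and
  \<open>P q \<subseteq> P\<close>. A group is not the union of two proper subgroups, so one
  \<open>p\<close> violates both inclusions; one of \<open>p1\<close>, \<open>p2\<close>,
  \<open>p1 \<oplus> p2\<close> will do.\<close>

lemma obtain_uniformizer:
  obtains p where "p \<in> P" "p \<noteq> \<zero>" "q \<otimes> p \<in> R - P" "p \<otimes> q \<in> R - P"
proof -
  obtain p1 where p1: "p1 \<in> P" "q \<otimes> p1 \<notin> P" using maximal_l[OF P_twosided q(1)] q(2) by blast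
  obtain p2 where p2: "p2 \<in> P" "p2 \<otimes> q \<notin> P" using maximal_r[OF P_twosided q(1)] q(2) by blast
  have carr: "p1 \<in> carrier Q" "p2 \<in> carrier Q" using p1 p2 by simp_all
  have diff: "x \<in> P" if "x \<oplus> y \<in> P" "y \<in> P" "x \<in> carrier Q" for x y
  proof -
    have "x \<oplus> y \<oplus> \<ominus> y \<in> P" using that minus_in_P by simp
    moreover have "x \<oplus> y \<oplus> \<ominus> y = x" using that by (simp add: a_assoc r_neg)
    ultimately show ?thesis by simp
  qed
  have "\<exists>p \<in> P. q \<otimes> p \<notin> P \<and> p \<otimes> q \<notin> P"
  proof (cases "p1 \<otimes> q \<in> P \<and> q \<otimes> p2 \<in> P")
    case True
    have "q \<otimes> (p1 \<oplus> p2) \<notin> P"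
      using diff[of "q \<otimes> p1" "q \<otimes> p2"] True p1 carr q by (auto simp: r_distr)
    moreover have "(p1 \<oplus> p2) \<otimes> q \<notin> P"
      using diff[of "p2 \<otimes> q" "p1 \<otimes> q"] True p2 carr q by (auto simp: l_distr a_comm)
    ultimately show ?thesis using p1 p2 by (intro bexI[of _ "p1 \<oplus> p2"]) auto
  qed (use p1 p2 in blast)
  then obtain p where p: "p \<in> P" "q \<otimes> p \<notin> P" "p \<otimes> q \<notin> P" by blast
  moreover have "p \<noteq> \<zero>" using p q by auto
  ultimately show ?thesis using that q_P P_q by blast
qed

text \<open>In \<open>s \<otimes> r = r1 \<otimes> s\<close> the product lies in the prime ideal
  \<open>P\<close> and \<open>s\<close> does not, so \<open>r1\<close> does.\<close>

lemma normalizes_P_complement: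
  assumes "s \<in> R - P"
  shows "normalizes Q P s"
proof -
  have s: "s \<in> R" "s \<notin> P" "s \<noteq> \<zero>" using assms by auto
  have nR: "normalizes Q R s" using normalizes_R s by simp
  have "(\<exists>r'\<in>P. s \<otimes> r = r' \<otimes> s) \<and> (\<exists>r'\<in>P. r \<otimes> s = s \<otimes> r')" if r: "r \<in> P" for r
  proof
    obtain r1 where r1: "r1 \<in> R" "s \<otimes> r = r1 \<otimes> s" by (rule normalizesD[OF nR P_in_R[OF r]])
    obtain r2 where r2: "r2 \<in> R" "r \<otimes> s = s \<otimes> r2" by (rule normalizesD'[OF nR P_in_R[OF r]])
    have "r1 \<in> P"
    proof (rule ccontr)
      assume "r1 \<notin> P"
      moreover have "r1 \<otimes> s \<in> P" using r1 r s by (metis P_simps(2))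
      ultimately show False using prime[of r1 s] r1 s by blast
    qed
    then show "\<exists>r'\<in>P. s \<otimes> r = r' \<otimes> s" using r1 by blast
    have "r2 \<in> P" using prime[of s r2] r2 r s by (metis P_simps(3))
    then show "\<exists>r'\<in>P. r \<otimes> s = s \<otimes> r'" using r2 by blast
  qed
  then show ?thesis using s by (simp add: normalizes_def)
qed

text \<open>Write \<open>q\<close> as \<open>(q \<otimes> p) \<otimes> inv p\<close> with the
  \<open>p\<close> of \<open>obtain_uniformizer\<close>. The first factor is outside
  \<open>P\<close>. For \<open>p\<close> itself, multiplying
  \<open>p \<otimes> r = r1 \<otimes> p\<close> by \<open>q\<close> on the right puts
  \<open>r1 \<otimes> (p \<otimes> q)\<close> into \<open>P\<close>, and
  \<open>p \<otimes> q\<close> is outside \<open>P\<close>.\<close>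

lemma normalizes_P_q: "normalizes Q P q"
proof -
  obtain p where p: "p \<in> P" "p \<noteq> \<zero>" "q \<otimes> p \<in> R - P" "p \<otimes> q \<in> R - P"
    by (rule obtain_uniformizer)
  have carr: "p \<in> carrier Q" using p by simp
  have nR: "normalizes Q R p" using normalizes_R carr p by simp
  have "(\<exists>r'\<in>P. p \<otimes> r = r' \<otimes> p) \<and> (\<exists>r'\<in>P. r \<otimes> p = p \<otimes> r')" if r: "r \<in> P" for r
  proof
    obtain r1 where r1: "r1 \<in> R" "p \<otimes> r = r1 \<otimes> p" by (rule normalizesD[OF nR P_in_R[OF r]])
    obtain r2 where r2: "r2 \<in> R" "r \<otimes> p = p \<otimes> r2" by (rule normalizesD'[OF nR P_in_R[OF r]])
    have "r1 \<otimes> (p \<otimes> q) = p \<otimes> (r \<otimes> q)"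
      using r1 r carr q by (simp add: m_assoc[symmetric])
    then have "r1 \<otimes> (p \<otimes> q) \<in> P" using p P_q[OF r] by simp
    then have "r1 \<in> P" using prime[of r1 "p \<otimes> q"] r1 p by blast
    then show "\<exists>r'\<in>P. p \<otimes> r = r' \<otimes> p" using r1 by blast
    have "(q \<otimes> p) \<otimes> r2 = (q \<otimes> r) \<otimes> p"
      using r2 r carr q by (simp add: m_assoc)
    then have "(q \<otimes> p) \<otimes> r2 \<in> P" using p q_P[OF r] by simp
    then have "r2 \<in> P" using prime[of "q \<otimes> p" r2] r2 p by blast
    then show "\<exists>r'\<in>P. r \<otimes> p = p \<otimes> r'" using r2 by blast
  qed
  then have np: "normalizes Q P p" using carr p by (simp add: normalizes_def)
  have "q = q \<otimes> p \<otimes> inv p" using q carr p inv_nonzero[OF carr p(2)] by (simp add: m_assoc)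
  then show ?thesis
    using normalizes_mult[OF P_carrier normalizes_P_complement[OF p(3)] normalizes_inv[OF P_carrier np]]
    by simp
qed

lemma normalizes_complement_q_pow: "normalizes Q (R - P) (q [^] (n::nat))"
  by (intro normalizes_pow normalizes_Diff normalizes_R normalizes_P_q)
    (use R_carrier P_subset q q_nonzero in auto)

text \<open>The exponent is the value of \<open>r\<close> at \<open>P\<close>. If all
  \<open>q [^] n \<otimes> r\<close> were in \<open>R\<close>, the elements with this property would
  form a nonzero ideal stable under \<open>q\<close>, forcing \<open>q \<in> R\<close>.\<close>

lemma q_pow_in_complement:
  assumes r: "r \<in> R" "r \<noteq> \<zero>"
  shows "\<exists>n::nat. q [^] n \<otimes> r \<in> R - P"
proof -
  define I where "I = {x \<in> R. \<forall>n::nat. q [^] n \<otimes> x \<in> R}"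
  have pow: "q [^] (n::nat) \<in> carrier Q" for n using q by simp
  have "r \<notin> I"
  proof
    assume "r \<in> I"
    moreover have "q [^] (n::nat) \<otimes> (x \<otimes> s) \<in> R \<and> q [^] n \<otimes> (s \<otimes> x) \<in> R"
      if "x \<in> R" "s \<in> R" "q [^] n \<otimes> x \<in> R" for x s n
    proof -
      obtain s' where s': "s' \<in> R" "q [^] n \<otimes> s = s' \<otimes> q [^] n" using swap_R pow \<open>s \<in> R\<close> .
      have "q [^] n \<otimes> (s \<otimes> x) = s' \<otimes> (q [^] n \<otimes> x)"
        using s' that pow by (simp add: m_assoc[symmetric])
      moreover have "q [^] n \<otimes> (x \<otimes> s) = (q [^] n \<otimes> x) \<otimes> s"
        using that pow by (simp add: m_assoc)
      ultimately show ?thesis using s'(1) that by simp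
    qed
    ultimately have "nonzero_twosided Q R I"
      unfolding nonzero_twosided_def I_def using r pow by (auto simp: r_distr)
    moreover have "q \<otimes> x \<in> I" if "x \<in> I" for x
    proof -
      have x: "x \<in> R" and "q [^] (n::nat) \<otimes> x \<in> R" for n using that by (auto simp: I_def)
      then have "q [^] (Suc n) \<otimes> x \<in> R" for n by blast
      then have "q [^] n \<otimes> (q \<otimes> x) \<in> R" for n :: nat using q x by (simp add: m_assoc)
      moreover from this[of 0] have "q \<otimes> x \<in> R" using q x by simp
      ultimately show ?thesis by (simp add: I_def)
    qed
    ultimately have "q \<in> R" using maximal_l q by blast
    then show False using q by blast
  qed
  then have ex: "\<exists>n::nat. q [^] n \<otimes> r \<notin> R" using r by (auto simp: I_def)
  \<comment> \<open>The value is the predecessor \<open>m\<close> of the first exponent that leaves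
    \<open>R\<close>: one more factor \<open>q\<close> leads out of \<open>R\<close>, so
    \<open>q [^] m \<otimes> r\<close> is not in \<open>P\<close>.\<close>
  define n where "n = (LEAST n::nat. q [^] n \<otimes> r \<notin> R)"
  have n: "q [^] n \<otimes> r \<notin> R" unfolding n_def by (rule LeastI_ex[OF ex])
  then have "n \<noteq> 0" using r by (metis R_closed l_one nat_pow_0)
  then obtain m where m: "n = Suc m" by (cases n) auto
  have mR: "q [^] m \<otimes> r \<in> R"
    using not_less_Least[of m "\<lambda>n::nat. q [^] n \<otimes> r \<notin> R"] m unfolding n_def by auto
  have "q [^] n \<otimes> r = q \<otimes> (q [^] m \<otimes> r)"
    unfolding m nat_pow_Suc2[OF q(1)] using r q by (simp add: m_assoc)
  then have "q [^] m \<otimes> r \<notin> P" using n q_P by auto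
  then show ?thesis using mR by blast
qed

lemma complement_mult: "\<lbrakk>s \<in> R - P; t \<in> R - P\<rbrakk> \<Longrightarrow> s \<otimes> t \<in> R - P"
  using prime[of s t] by auto

text \<open>Additivity of the value: \<open>q [^] m\<close> is moved past
  \<open>q [^] n \<otimes> a\<close>, which changes but stays in the complement of
  \<open>P\<close>.\<close>

lemma q_pow_mult_in_complement:
  assumes ab: "a \<in> R" "b \<in> R" and s: "q [^] (n::nat) \<otimes> a \<in> R - P" and t: "q [^] (m::nat) \<otimes> b \<in> R - P"
  shows "q [^] (n + m) \<otimes> (a \<otimes> b) \<in> R - P"
proof -
  obtain s' where s': "s' \<in> R - P" "q [^] m \<otimes> (q [^] n \<otimes> a) = s' \<otimes> q [^] m"
    using normalizesD[OF normalizes_complement_q_pow s] .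
  have "q [^] (n + m) \<otimes> (a \<otimes> b) = q [^] m \<otimes> (q [^] n \<otimes> a) \<otimes> b"
    using ab q nat_pow_mult[of q m n] by (simp add: m_assoc[symmetric] add.commute)
  also have "\<dots> = s' \<otimes> (q [^] m \<otimes> b)"
    unfolding s'(2) using s' ab q by (simp add: m_assoc)
  finally show ?thesis using complement_mult s'(1) t by simp
qed

text \<open>Both products have the value \<open>n + m\<close>, so for
  \<open>g = q [^] (n + m)\<close> neither \<open>g \<otimes> (a \<otimes> b)\<close> nor
  \<open>g \<otimes> (b \<otimes> a)\<close> is in \<open>P\<close>. Conjugation moves
  \<open>g\<close> to the right, and \<open>b \<otimes> a \<otimes> g\<close> becomes a denominator
  outside \<open>P\<close>.\<close>

lemma commutator_denominator:
  assumes a: "a \<in> R" "a \<noteq> \<zero>" and b: "b \<in> R" "b \<noteq> \<zero>"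
  shows "\<not> denominators Q R (a \<otimes> b \<otimes> inv (b \<otimes> a)) \<subseteq> P"
proof -
  obtain n m :: nat where nm: "q [^] n \<otimes> a \<in> R - P" "q [^] m \<otimes> b \<in> R - P"
    using q_pow_in_complement a b by meson
  define g where "g = q [^] (n + m)"
  have g: "g \<in> carrier Q" "g \<noteq> \<zero>"
    using normalizes_complement_q_pow[of "n + m"] by (auto simp: normalizes_def g_def)
  have right: "x \<otimes> g \<in> R - P" if x: "g \<otimes> x \<in> R - P" "x \<in> carrier Q" for x
  proof -
    have "normalizes Q (R - P) g" unfolding g_def by (rule normalizes_complement_q_pow)
    then obtain y where y: "y \<in> R - P" "g \<otimes> x \<otimes> g = g \<otimes> y" using normalizesD' x(1) by blast
    then have "x \<otimes> g = y" using l_cancel_nonzero[OF g] x g by (simp add: m_assoc)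
    then show ?thesis using y by simp
  qed
  have "g \<otimes> (a \<otimes> b) \<in> R - P" "g \<otimes> (b \<otimes> a) \<in> R - P"
    unfolding g_def
    using q_pow_mult_in_complement[OF a(1) b(1) nm] q_pow_mult_in_complement[OF b(1) a(1) nm(2,1)]
    by (simp_all only: add.commute)
  then have ab: "a \<otimes> b \<otimes> g \<in> R - P" and ba: "b \<otimes> a \<otimes> g \<in> R - P"
    using right a(1) b(1) by (meson R_closed m_closed)+
  have ba0: "b \<otimes> a \<in> carrier Q" "b \<otimes> a \<noteq> \<zero>" using a b m_nonzero by auto
  note iba = inv_nonzero[OF ba0]
  have "a \<otimes> b \<otimes> inv (b \<otimes> a) \<otimes> (b \<otimes> a \<otimes> g) = a \<otimes> b \<otimes> (inv (b \<otimes> a) \<otimes> (b \<otimes> a)) \<otimes> g"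
    using a b g ba0(1) iba(1) by (simp add: m_assoc)
  also have "\<dots> = a \<otimes> b \<otimes> g" unfolding iba(3) using a b by simp
  finally show ?thesis using ab ba by (auto simp: denominators_def)
qed

end

text \<open>If \<open>c = a \<otimes> b \<otimes> inv (b \<otimes> a)\<close> were not in
  \<open>R\<close>, the chain condition would give a maximal proper ideal of denominators above that
  of \<open>c\<close>, contradicting \<open>commutator_denominator\<close>.\<close>

lemma (in normalizing_krull_order) commutes_up_to_factor:
  assumes acc: "\<And>f :: nat \<Rightarrow> 'a. \<lbrakk>\<And>n. f n \<in> carrier Q; \<And>n. f n \<notin> R;
      \<And>n. denominators Q R (f n) \<subseteq> denominators Q R (f (Suc n))\<rbrakk> \<Longrightarrow>
      \<exists>n. denominators Q R (f (Suc n)) = denominators Q R (f n)"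
    and a: "a \<in> R" "a \<noteq> \<zero>" and b: "b \<in> R" "b \<noteq> \<zero>"
  shows "\<exists>r \<in> R. a \<otimes> b = b \<otimes> a \<otimes> r"
proof -
  let ?J = "denominators Q R"
  have ba0: "b \<otimes> a \<in> carrier Q" "b \<otimes> a \<noteq> \<zero>" using a b m_nonzero by auto
  note iba = inv_nonzero[OF ba0]
  define c where "c = a \<otimes> b \<otimes> inv (b \<otimes> a)"
  have c: "c \<in> carrier Q" using a b iba by (simp add: c_def)
  have "c \<in> R"
  proof (rule ccontr)
    assume "c \<notin> R"
    define X where "X = {q \<in> carrier Q - R. ?J c \<subseteq> ?J q}"
    have "c \<in> X" using c \<open>c \<notin> R\<close> by (simp add: X_def)
    have "\<exists>q \<in> X. \<forall>q' \<in> carrier Q - R. ?J q \<subseteq> ?J q' \<longrightarrow> ?J q' = ?J q"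
    proof (rule ccontr)
      assume *: "\<not> (\<exists>q \<in> X. \<forall>q' \<in> carrier Q - R. ?J q \<subseteq> ?J q' \<longrightarrow> ?J q' = ?J q)"
      have "\<exists>q'. q' \<in> X \<and> ?J q \<subset> ?J q'" if qX: "q \<in> X" for q
      proof -
        obtain q' where q': "q' \<in> carrier Q - R" "?J q \<subseteq> ?J q'" "?J q' \<noteq> ?J q"
          using * qX by meson
        moreover have "?J c \<subseteq> ?J q" using qX by (simp add: X_def)
        ultimately show ?thesis unfolding X_def by (intro exI[of _ q']) blast
      qed
      then have "\<exists>f :: nat \<Rightarrow> 'a. \<forall>n. f n \<in> X \<and> ?J (f n) \<subset> ?J (f (Suc n))"
        by (intro dependent_nat_choice) (use \<open>c \<in> X\<close> in auto)
      then obtain f :: "nat \<Rightarrow> 'a" where f: "\<And>n. f n \<in> X" "\<And>n. ?J (f n) \<subset> ?J (f (Suc n))"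
        by blast
      have "\<exists>n. ?J (f (Suc n)) = ?J (f n)"
        by (rule acc) (use f in \<open>auto simp: X_def\<close>)
      then show False using f by blast
    qed
    then obtain q where "q \<in> X" and max: "\<And>q'. q' \<in> carrier Q - R \<Longrightarrow> ?J q \<subseteq> ?J q' \<Longrightarrow> ?J q' = ?J q"
      by blast
    interpret maximal_denominators Q R q "?J q"
      by unfold_locales (use \<open>q \<in> X\<close> max in \<open>auto simp: X_def\<close>)
    show False
      using commutator_denominator[OF a b] \<open>q \<in> X\<close> by (simp add: X_def c_def)
  qed
  \<comment> \<open>Here \<open>c\<close> stands to the left of \<open>b \<otimes> a\<close>; since
    \<open>b \<otimes> a\<close> normalizes \<open>R\<close>, it can be replaced by a factor on the
    right.\<close>
  then obtain r where r: "r \<in> R" "c \<otimes> (b \<otimes> a) = (b \<otimes> a) \<otimes> r"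
    using normalizesD'[OF normalizes_R[OF ba0]] by blast
  moreover have "c \<otimes> (b \<otimes> a) = a \<otimes> b"
    unfolding c_def using m_assoc[of "a \<otimes> b" "inv (b \<otimes> a)" "b \<otimes> a"] a b iba ba0 by simp
  ultimately show ?thesis by auto
qed

section \<open>Monoids of regular elements\<close>

lemma regular_monoid_simps [simp]:
  "carrier (regular_monoid R) = regular_elements R"
  "x \<otimes>\<^bsub>regular_monoid R\<^esub> y = x \<otimes>\<^bsub>R\<^esub> y"
  "\<one>\<^bsub>regular_monoid R\<^esub> = \<one>\<^bsub>R\<^esub>"
  by (simp_all add: regular_monoid_def)

context ring
begin

lemma regular_elements_carrier: "x \<in> regular_elements R \<Longrightarrow> x \<in> carrier R"
  by (simp add: regular_elements_def)

lemma regular_mult_closed: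
  assumes "a \<in> regular_elements R" "b \<in> regular_elements R"
  shows "a \<otimes> b \<in> regular_elements R"
  unfolding regular_elements_def
proof (intro CollectI conjI ballI impI)
  have ab: "a \<in> carrier R" "b \<in> carrier R" using assms regular_elements_carrier by auto
  then show "a \<otimes> b \<in> carrier R" by simp
  fix x assume x: "x \<in> carrier R"
  {
    assume "a \<otimes> b \<otimes> x = \<zero>"
    then have "a \<otimes> (b \<otimes> x) = \<zero>" using ab x by (simp add: m_assoc)
    then have "b \<otimes> x = \<zero>" using assms(1) ab x unfolding regular_elements_def by blast
    then show "x = \<zero>" using assms(2) x unfolding regular_elements_def by blast
  next
    assume "x \<otimes> (a \<otimes> b) = \<zero>"
    then have "(x \<otimes> a) \<otimes> b = \<zero>" using ab x by (simp add: m_assoc)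
    then have "x \<otimes> a = \<zero>" using assms(2) ab x unfolding regular_elements_def by blast
    then show "x = \<zero>" using assms(1) x unfolding regular_elements_def by blast
  }
qed

lemma regular_l_cancel:
  assumes "a \<in> regular_elements R" "x \<in> carrier R" "y \<in> carrier R" "a \<otimes> x = a \<otimes> y"
  shows "x = y"
proof -
  have "a \<otimes> (x \<ominus> y) = \<zero>"
    using assms regular_elements_carrier by (simp add: minus_eq r_distr r_minus r_neg)
  moreover have "x \<ominus> y \<in> carrier R" using assms(2,3) by simp
  ultimately have "x \<ominus> y = \<zero>" using assms(1) unfolding regular_elements_def by blast
  then show ?thesis using assms by simp
qed

lemma regular_r_cancel:
  assumes "a \<in> regular_elements R" "x \<in> carrier R" "y \<in> carrier R" "x \<otimes> a = y \<otimes> a"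
  shows "x = y"
proof -
  have "(x \<ominus> y) \<otimes> a = \<zero>"
    using assms regular_elements_carrier by (simp add: minus_eq l_distr l_minus r_neg)
  moreover have "x \<ominus> y \<in> carrier R" using assms(2,3) by simp
  ultimately have "x \<ominus> y = \<zero>" using assms(1) unfolding regular_elements_def by blast
  then show ?thesis using assms by simp
qed

lemma regular_monoid_cancel: "monoid_cancel (regular_monoid R)"
proof -
  have "\<one> \<in> regular_elements R" by (simp add: regular_elements_def)
  then interpret monoid "regular_monoid R"
    by (intro monoidI) (auto simp: regular_mult_closed regular_elements_carrier m_assoc)
  show ?thesis
    by (rule monoid_cancelI)
      (auto intro: regular_l_cancel regular_r_cancel simp: regular_elements_carrier)
qed

end

lemma (in cring) regular_factor:
  assumes "a \<in> carrier R" "b \<in> carrier R" "a \<otimes> b \<in> regular_elements R"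
  shows "b \<in> regular_elements R"
proof -
  have zero: "x = \<zero>" if x: "x \<in> carrier R" "b \<otimes> x = \<zero>" for x
  proof -
    have "a \<otimes> b \<otimes> x = \<zero>" using assms(1,2) x by (simp add: m_assoc)
    then show ?thesis using assms(3) x(1) unfolding regular_elements_def by blast
  qed
  moreover have "x = \<zero>" if "x \<in> carrier R" "x \<otimes> b = \<zero>" for x
    using zero[of x] that m_comm[of x b] assms(2) by metis
  ultimately show ?thesis
    using assms(2) unfolding regular_elements_def by blast
qed

text \<open>
  If \<open>a z = b w\<close>, then \<open>a\<close> divides \<open>w (b + a t)\<close> for every \<open>t\<close>. The choice \<open>t = 1 + b r\<close> prevents
  \<open>b\<close> from dividing \<open>b + a t\<close>, and leaves \<open>r\<close> free to make \<open>b + a t\<close> regular.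
\<close>

lemma (in cring) exchange_additively_regular:
  assumes "additively_regular R"
  shows "exchange (regular_monoid R)"
  unfolding exchange_def regular_monoid_simps
proof (intro ballI impI, elim conjE)
  let ?H = "regular_monoid R" and ?Reg = "regular_elements R"
  fix a b z w
  assume reg: "a \<in> ?Reg" "b \<in> ?Reg" "z \<in> ?Reg" "w \<in> ?Reg"
    and eq: "a \<otimes> z = b \<otimes> w" and ndvd: "\<not> a divides\<^bsub>?H\<^esub> b" "\<not> b divides\<^bsub>?H\<^esub> a"
  have carr: "a \<in> carrier R" "b \<in> carrier R" "z \<in> carrier R" "w \<in> carrier R"
    using reg regular_elements_carrier by auto
  \<comment> \<open>Additive regularity is applied to \<open>a \<oplus> b\<close> and the regular
    \<open>a \<otimes> b\<close>, because \<open>b + a (1 + b r)\<close> expands to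
    \<open>(a + b) + (a b) r\<close>.\<close>
  obtain r where r: "r \<in> carrier R" "(a \<oplus> b) \<oplus> (a \<otimes> b) \<otimes> r \<in> ?Reg"
    using assms carr regular_mult_closed[OF reg(1,2)] unfolding additively_regular_def
    by (meson a_closed)
  define t where "t = \<one> \<oplus> b \<otimes> r"
  define y where "y = b \<oplus> a \<otimes> t"
  define x where "x = z \<oplus> w \<otimes> t"
  have t: "t \<in> carrier R" using carr r by (simp add: t_def)
  have "y = (a \<oplus> b) \<oplus> (a \<otimes> b) \<otimes> r"
    unfolding y_def t_def using carr r(1) by algebra
  then have y: "y \<in> ?Reg" using r by simp
  have ax: "a \<otimes> x = w \<otimes> y"
    unfolding x_def y_def using carr t eq by algebra
  have "a \<otimes> x \<in> ?Reg" unfolding ax using reg y by (simp add: regular_mult_closed)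
  then have x: "x \<in> ?Reg" using regular_factor[of a x] carr t by (simp add: x_def)
  have "\<not> a divides\<^bsub>?H\<^esub> y"
  proof
    assume "a divides\<^bsub>?H\<^esub> y"
    then obtain c where c: "c \<in> ?Reg" "y = a \<otimes> c" by (auto simp: factor_def)
    have cc: "c \<in> carrier R" using c regular_elements_carrier by simp
    have "b = y \<ominus> a \<otimes> t" unfolding y_def using carr t by algebra
    then have b: "b = a \<otimes> (c \<ominus> t)" unfolding c(2) using carr t cc by algebra
    \<comment> \<open>Divisibility in the monoid asks for a regular cofactor; a factor of the
      regular \<open>b\<close> is regular.\<close>
    then have "c \<ominus> t \<in> ?Reg"
      using reg(2) regular_factor[of a "c \<ominus> t"] carr t cc by simp
    then show False using ndvd(1) b by (auto simp: factor_def)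
  qed
  moreover have "\<not> b divides\<^bsub>?H\<^esub> y"
  proof
    assume "b divides\<^bsub>?H\<^esub> y"
    then obtain c where c: "c \<in> ?Reg" "y = b \<otimes> c" by (auto simp: factor_def)
    have cc: "c \<in> carrier R" using c regular_elements_carrier by simp
    have "a = y \<ominus> b \<ominus> a \<otimes> b \<otimes> r" unfolding y_def t_def using carr r(1) by algebra
    then have a: "a = b \<otimes> (c \<ominus> \<one> \<ominus> a \<otimes> r)" unfolding c(2) using carr r(1) cc by algebra
    then have "c \<ominus> \<one> \<ominus> a \<otimes> r \<in> ?Reg"
      using reg(1) regular_factor[of b "c \<ominus> \<one> \<ominus> a \<otimes> r"] carr r(1) cc by simp
    then show False using ndvd(2) a by (auto simp: factor_def)
  qed
  ultimately show "\<exists>x\<in>?Reg. \<exists>y\<in>?Reg. a \<otimes> x = w \<otimes> y \<and>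
      \<not> a divides\<^bsub>?H\<^esub> y \<and> \<not> b divides\<^bsub>?H\<^esub> y"
    using ax x y by blast
qed

lemma (in cring) regular_comm_up_to_units: "comm_up_to_units (regular_monoid R)"
proof -
  interpret H: monoid_cancel "regular_monoid R" by (rule regular_monoid_cancel)
  have "comm_monoid_cancel (regular_monoid R)"
    by unfold_locales (simp add: m_comm regular_elements_carrier)
  then show ?thesis by (rule comm_monoid_cancel.is_comm_up_to_units)
qed

section \<open>Normalizing prime rings\<close>

locale normalizing_prime_ring = ring S for S (structure) +
  assumes prime: "prime_ring S" and normal: "normalizing S"
begin

lemma one_not_zero: "\<one> \<noteq> \<zero>"
  using prime by (simp add: prime_ring_def)

lemma swap:
  assumes "a \<in> carrier S" "r \<in> carrier S"
  obtains r' where "r' \<in> carrier S" "a \<otimes> r = r' \<otimes> a"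
proof -
  have "a \<otimes> r \<in> a <# carrier S" using assms by (auto simp: l_coset_def)
  then have "a \<otimes> r \<in> carrier S #> a" using normal assms by (simp add: normalizing_def)
  then show ?thesis using that by (auto simp: r_coset_def)
qed

lemma swap':
  assumes "a \<in> carrier S" "r \<in> carrier S"
  obtains r' where "r' \<in> carrier S" "r \<otimes> a = a \<otimes> r'"
proof -
  have "r \<otimes> a \<in> carrier S #> a" using assms by (auto simp: r_coset_def)
  then have "r \<otimes> a \<in> a <# carrier S" using normal assms by (simp add: normalizing_def)
  then show ?thesis using that by (auto simp: l_coset_def)
qed

text \<open>Normality moves any middle factor out, \<open>a x b = x' a b = 0\<close>, so primeness
  applies.\<close>

lemma no_zero_divisors:
  assumes "a \<in> carrier S" "b \<in> carrier S" "a \<otimes> b = \<zero>"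
  shows "a = \<zero> \<or> b = \<zero>"
proof -
  have "a \<otimes> x \<otimes> b = \<zero>" if x: "x \<in> carrier S" for x
  proof -
    obtain x' where "x' \<in> carrier S" "a \<otimes> x = x' \<otimes> a" by (rule swap[OF assms(1) x])
    then show ?thesis using assms by (simp add: m_assoc)
  qed
  then show ?thesis using prime assms unfolding prime_ring_def by blast
qed

lemma regular_eq: "regular_elements S = carrier S - {\<zero>}"
proof -
  have "a \<noteq> \<zero>" if "a \<in> regular_elements S" for a
  proof
    assume "a = \<zero>"
    then have "\<forall>x \<in> carrier S. x = \<zero>" using that by (simp add: regular_elements_def)
    then show False using one_not_zero by blast
  qed
  moreover have "a \<in> regular_elements S" if "a \<in> carrier S" "a \<noteq> \<zero>" for a
    using that no_zero_divisors by (auto simp: regular_elements_def)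
  ultimately show ?thesis using regular_elements_carrier by blast
qed

text \<open>
  Here \<open>a z = b w = w b u\<close> for a unit \<open>u\<close>, and normality of \<open>a\<close> shows that \<open>w (b u + a)\<close> is a right
  multiple of \<open>a\<close>.
\<close>

lemma exchange_domain:
  assumes "comm_up_to_units (regular_monoid S)"
  shows "exchange (regular_monoid S)"
  unfolding exchange_def regular_monoid_simps
proof (intro ballI impI, elim conjE)
  let ?H = "regular_monoid S" and ?Reg = "regular_elements S"
  interpret H: comm_up_to_units ?H by fact
  fix a b z w
  assume reg: "a \<in> ?Reg" "b \<in> ?Reg" "z \<in> ?Reg" "w \<in> ?Reg"
    and eq: "a \<otimes> z = b \<otimes> w" and ndvd: "\<not> a divides\<^bsub>?H\<^esub> b" "\<not> b divides\<^bsub>?H\<^esub> a"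
  have carr: "a \<in> carrier S" "b \<in> carrier S" "z \<in> carrier S" "w \<in> carrier S"
    using reg regular_elements_carrier by auto
  have dvdI: "c divides\<^bsub>?H\<^esub> d" if "c \<in> carrier S" "d \<in> ?Reg" "e \<in> carrier S" "d = c \<otimes> e" for c d e
  proof -
    have "e \<noteq> \<zero>" using that by (auto simp: regular_eq)
    then have "e \<in> ?Reg" using that(3) by (simp add: regular_eq)
    then show ?thesis using that(4) unfolding factor_def regular_monoid_simps by blast
  qed
  obtain u where u: "u \<in> Units ?H" "b \<otimes> w = w \<otimes> b \<otimes> u"
    using H.m_comm_unit[of b w] reg by auto
  obtain v where v: "v \<in> ?Reg" "u \<otimes> v = \<one>"
    using u(1) by (auto simp: Units_def)
  have uc: "u \<in> carrier S" "v \<in> carrier S"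
    using H.Units_closed[OF u(1)] v regular_elements_carrier by auto
  define y where "y = b \<otimes> u \<oplus> a"
  have y: "y \<in> carrier S" using carr uc by (simp add: y_def)
  obtain w' where w': "w' \<in> carrier S" "w \<otimes> a = a \<otimes> w'" by (rule swap'[OF carr(1,4)])
  define x where "x = z \<oplus> w'"
  have x: "x \<in> carrier S" using carr w' by (simp add: x_def)
  have "a \<otimes> x = w \<otimes> (b \<otimes> u) \<oplus> w \<otimes> a"
    unfolding x_def using carr uc w' eq u(2) by (simp add: r_distr m_assoc)
  then have ax: "a \<otimes> x = w \<otimes> y"
    using carr uc by (simp add: y_def r_distr)
  have nb: "\<not> (\<exists>c \<in> carrier S. y = b \<otimes> c)"
  proof
    assume "\<exists>c \<in> carrier S. y = b \<otimes> c"
    then obtain c where c: "c \<in> carrier S" "y = b \<otimes> c" by blast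
    have "a = \<ominus> (b \<otimes> u) \<oplus> y" unfolding y_def using carr uc by (simp add: r_neg1)
    then have "a = b \<otimes> (\<ominus> u \<oplus> c)" unfolding c(2) using carr uc c(1) by (simp add: r_distr r_minus)
    then have "b divides\<^bsub>?H\<^esub> a" using dvdI[of b a "\<ominus> u \<oplus> c"] carr reg uc c by simp
    then show False using ndvd by blast
  qed
  have na: "\<not> (\<exists>c \<in> carrier S. y = a \<otimes> c)"
  proof
    assume "\<exists>c \<in> carrier S. y = a \<otimes> c"
    then obtain c where c: "c \<in> carrier S" "y = a \<otimes> c" by blast
    have "b \<otimes> u = y \<ominus> a" unfolding y_def using carr uc by (simp add: minus_eq a_assoc r_neg)
    also have "\<dots> = a \<otimes> (c \<ominus> \<one>)" unfolding c(2) using carr c(1) by (simp add: minus_eq r_distr r_minus)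
    finally have "b \<otimes> u \<otimes> v = a \<otimes> (c \<ominus> \<one>) \<otimes> v" by simp
    then have "b = a \<otimes> ((c \<ominus> \<one>) \<otimes> v)" using carr uc v c(1) by (simp add: m_assoc)
    then have "a divides\<^bsub>?H\<^esub> b" using dvdI[of a b "(c \<ominus> \<one>) \<otimes> v"] carr reg uc c by simp
    then show False using ndvd by blast
  qed
  have "y \<noteq> \<zero>" using na carr(1) by (metis r_null zero_closed)
  then have yr: "y \<in> ?Reg" using y regular_eq by simp
  then have "a \<otimes> x \<in> ?Reg" unfolding ax using reg by (simp add: regular_mult_closed)
  then have "x \<in> ?Reg" using x carr by (auto simp: regular_eq)
  moreover have "\<not> a divides\<^bsub>?H\<^esub> y" "\<not> b divides\<^bsub>?H\<^esub> y"
    using na nb regular_elements_carrier by (auto simp: factor_def)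
  ultimately show "\<exists>x\<in>?Reg. \<exists>y\<in>?Reg. a \<otimes> x = w \<otimes> y \<and>
      \<not> a divides\<^bsub>?H\<^esub> y \<and> \<not> b divides\<^bsub>?H\<^esub> y"
    using ax yr by blast
qed

end

section \<open>Transfer to the image of the ring in its quotient ring\<close>

locale normalizing_krull_ring = normalizing_prime_ring +
  fixes Q e
  assumes quotient: "is_quotient_ring S Q e"
    and maximal: "maximal_order S Q e"
    and acc: "ascending_chain_condition {I. divisorial S Q e I}"
begin

sublocale Q: ring Q
  using quotient by (simp add: is_quotient_ring_def)

lemma e_hom: "e \<in> ring_hom S Q"
  using quotient by (simp add: is_quotient_ring_def)

lemma e_simps [simp]:
  "x \<in> carrier S \<Longrightarrow> e x \<in> carrier Q"
  "\<lbrakk>x \<in> carrier S; y \<in> carrier S\<rbrakk> \<Longrightarrow> e (x \<otimes> y) = e x \<otimes>\<^bsub>Q\<^esub> e y"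
  "\<lbrakk>x \<in> carrier S; y \<in> carrier S\<rbrakk> \<Longrightarrow> e (x \<oplus> y) = e x \<oplus>\<^bsub>Q\<^esub> e y"
  "e \<one> = \<one>\<^bsub>Q\<^esub>"
  "e \<zero> = \<zero>\<^bsub>Q\<^esub>"
  using ring_hom_memE[OF e_hom] ring_hom_zero[OF e_hom ring_axioms Q.ring_axioms] by auto

lemma e_inj: "inj_on e (carrier S)"
  using quotient by (simp add: is_quotient_ring_def)

lemma e_eq_iff [simp]: "\<lbrakk>x \<in> carrier S; y \<in> carrier S\<rbrakk> \<Longrightarrow> e x = e y \<longleftrightarrow> x = y"
  using e_inj by (auto dest: inj_onD)

lemma e_eq_zero_iff [simp]: "x \<in> carrier S \<Longrightarrow> e x = \<zero>\<^bsub>Q\<^esub> \<longleftrightarrow> x = \<zero>"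
  using e_eq_iff[of x \<zero>] by simp

lemma e_subring: "subring (e ` carrier S) Q"
proof (rule Q.subringI)
  fix h assume "h \<in> e ` carrier S"
  then obtain x where x: "x \<in> carrier S" "h = e x" by blast
  have "e (\<ominus> x) \<oplus>\<^bsub>Q\<^esub> e x = \<zero>\<^bsub>Q\<^esub>"
    using x e_simps(3)[of "\<ominus> x" x] by (simp add: l_neg del: e_simps(3))
  then have "\<ominus>\<^bsub>Q\<^esub> e x = e (\<ominus> x)" using x by (intro Q.minus_equality) auto
  then show "\<ominus>\<^bsub>Q\<^esub> h \<in> e ` carrier S" using x by auto
qed (auto simp flip: e_simps(2-4))

lemma fraction:
  assumes "q \<in> carrier Q"
  obtains a s where "a \<in> carrier S" "s \<in> regular_elements S" "q = e a \<otimes>\<^bsub>Q\<^esub> inv\<^bsub>Q\<^esub> (e s)"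
  using quotient assms unfolding is_quotient_ring_def by blast

lemma e_Units: "s \<in> regular_elements S \<Longrightarrow> e s \<in> Units Q"
  using quotient unfolding is_quotient_ring_def by blast

lemma ideal_of_twosided:
  assumes I: "nonzero_twosided Q (e ` carrier S) I"
  shows "ideal {x \<in> carrier S. e x \<in> I} S" "e ` {x \<in> carrier S. e x \<in> I} = I"
    "{x \<in> carrier S. e x \<in> I} \<noteq> {\<zero>}"
proof -
  have mult: "e (r \<otimes> x) \<in> I" "e (x \<otimes> r) \<in> I" if "x \<in> carrier S" "e x \<in> I" "r \<in> carrier S" for r x
    using I that by (auto simp: nonzero_twosided_def)
  show im: "e ` {x \<in> carrier S. e x \<in> I} = I"
    using I by (auto simp: nonzero_twosided_def)
  obtain x where x: "x \<in> I" "x \<noteq> \<zero>\<^bsub>Q\<^esub>"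
    using I by (auto simp: nonzero_twosided_def)
  show "{x \<in> carrier S. e x \<in> I} \<noteq> {\<zero>}"
  proof
    assume "{x \<in> carrier S. e x \<in> I} = {\<zero>}"
    then have "I = {\<zero>\<^bsub>Q\<^esub>}" using im by simp
    then show False using x by simp
  qed
  show "ideal {x \<in> carrier S. e x \<in> I} S"
  proof (rule idealI[OF ring_axioms])
    show "subgroup {x \<in> carrier S. e x \<in> I} (add_monoid S)"
    proof (rule add.subgroupI)
      show "{x \<in> carrier S. e x \<in> I} \<noteq> {}" using im x by blast
      fix a assume a: "a \<in> {x \<in> carrier S. e x \<in> I}"
      have "\<ominus> a = (\<ominus> \<one>) \<otimes> a" using a by (simp add: l_minus)
      then show "\<ominus> a \<in> {x \<in> carrier S. e x \<in> I}" using a mult(1)[of a "\<ominus> \<one>"] by auto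
    qed (use I in \<open>auto simp: nonzero_twosided_def\<close>)
  qed (use mult in auto)
qed

sublocale O: normalizing_krull_order Q "e ` carrier S"
proof (intro normalizing_krull_order.intro normalizing_krull_order_axioms.intro
    division_ring.intro division_ring_axioms.intro)
  let ?R = "e ` carrier S"
  show "ring Q" by (rule Q.ring_axioms)
  show one: "\<one>\<^bsub>Q\<^esub> \<noteq> \<zero>\<^bsub>Q\<^esub>"
    using one_not_zero e_eq_zero_iff[of \<one>] by simp
  show "x \<in> Units Q" if x: "x \<in> carrier Q" "x \<noteq> \<zero>\<^bsub>Q\<^esub>" for x
  proof -
    obtain a s where as: "a \<in> carrier S" "s \<in> regular_elements S" "x = e a \<otimes>\<^bsub>Q\<^esub> inv\<^bsub>Q\<^esub> (e s)"
      by (rule fraction[OF x(1)])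
    have "a \<noteq> \<zero>" using as x e_Units[of s] by auto
    then have "e a \<in> Units Q" using as regular_eq e_Units by simp
    then show ?thesis unfolding as(3) using as e_Units by simp
  qed
  show "subring ?R Q" by (rule e_subring)
  show "\<exists>a\<in>?R. \<exists>s\<in>?R. s \<noteq> \<zero>\<^bsub>Q\<^esub> \<and> x = a \<otimes>\<^bsub>Q\<^esub> inv\<^bsub>Q\<^esub> s" if "x \<in> carrier Q" for x
  proof -
    obtain a s where "a \<in> carrier S" "s \<in> regular_elements S" "x = e a \<otimes>\<^bsub>Q\<^esub> inv\<^bsub>Q\<^esub> (e s)"
      by (rule fraction[OF \<open>x \<in> carrier Q\<close>])
    then show ?thesis using regular_eq by auto
  qed
  show "normalizes Q ?R a" if a: "a \<in> ?R" "a \<noteq> \<zero>\<^bsub>Q\<^esub>" for a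
  proof -
    obtain x where x: "x \<in> carrier S" "a = e x" using a(1) by blast
    have "(\<exists>r'\<in>?R. e x \<otimes>\<^bsub>Q\<^esub> e r = r' \<otimes>\<^bsub>Q\<^esub> e x) \<and> (\<exists>r'\<in>?R. e r \<otimes>\<^bsub>Q\<^esub> e x = e x \<otimes>\<^bsub>Q\<^esub> r')"
      if r: "r \<in> carrier S" for r
    proof
      obtain r' where "r' \<in> carrier S" "x \<otimes> r = r' \<otimes> x" by (rule swap[OF x(1) r])
      then show "\<exists>r'\<in>?R. e x \<otimes>\<^bsub>Q\<^esub> e r = r' \<otimes>\<^bsub>Q\<^esub> e x" using x r by (metis e_simps(2) imageI)
      obtain r' where "r' \<in> carrier S" "r \<otimes> x = x \<otimes> r'" by (rule swap'[OF x(1) r])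
      then show "\<exists>r'\<in>?R. e r \<otimes>\<^bsub>Q\<^esub> e x = e x \<otimes>\<^bsub>Q\<^esub> r'" using x r by (metis e_simps(2) imageI)
    qed
    then show ?thesis using that x by (auto simp: normalizes_def)
  qed
  fix I q
  assume I: "nonzero_twosided Q ?R I" and q: "q \<in> carrier Q"
  let ?I = "{x \<in> carrier S. e x \<in> I}"
  note I' = ideal_of_twosided[OF I]
  have "{q \<in> carrier Q. \<forall>x \<in> ?I. q \<otimes>\<^bsub>Q\<^esub> e x \<in> e ` ?I} = ?R \<and>
      {q \<in> carrier Q. \<forall>x \<in> ?I. e x \<otimes>\<^bsub>Q\<^esub> q \<in> e ` ?I} = ?R"
    using maximal[unfolded maximal_order_def, rule_format, of ?I] I'(1,3) by simp
  then have max: "{q \<in> carrier Q. \<forall>x \<in> ?I. q \<otimes>\<^bsub>Q\<^esub> e x \<in> I} = ?R"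
      "{q \<in> carrier Q. \<forall>x \<in> ?I. e x \<otimes>\<^bsub>Q\<^esub> q \<in> I} = ?R"
    unfolding I'(2) by simp_all
  show "q \<in> ?R" if "\<And>x. x \<in> I \<Longrightarrow> q \<otimes>\<^bsub>Q\<^esub> x \<in> I" using max(1) q that by blast
  show "q \<in> ?R" if "\<And>x. x \<in> I \<Longrightarrow> x \<otimes>\<^bsub>Q\<^esub> q \<in> I" using max(2) q that by blast
qed

text \<open>The preimages in \<open>S\<close> are divisorial by
  \<open>denominators_divisorial\<close>, so the Krull chain condition applies to them.\<close>

lemma denominators_acc:
  assumes f: "\<And>n. f n \<in> carrier Q"
    and mono: "\<And>n. denominators Q (e ` carrier S) (f n) \<subseteq> denominators Q (e ` carrier S) (f (Suc n))"
  shows "\<exists>n::nat. denominators Q (e ` carrier S) (f (Suc n)) = denominators Q (e ` carrier S) (f n)"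
proof -
  let ?R = "e ` carrier S"
  define I where "I n = {x \<in> carrier S. e x \<in> denominators Q ?R (f n)}" for n
  have im: "e ` I n = denominators Q ?R (f n)" and id: "ideal (I n) S" for n
    unfolding I_def using ideal_of_twosided[OF O.denominators_twosided[OF f]] by auto
  have "divisorial S Q e (I n)" for n
    unfolding divisorial_def im ideal_inverse_def using id O.denominators_divisorial[OF f] by blast
  moreover have "mono I"
    using mono by (intro incseq_SucI) (auto simp: I_def)
  ultimately obtain N where "\<forall>n \<ge> N. I n = I N"
    using acc unfolding ascending_chain_condition_def by blast
  then have "I (Suc N) = I N" by (meson le_SucI order_refl)
  then show ?thesis using im[of N] im[of "Suc N"] by (intro exI[of _ N]) simp
qed

text \<open>\<open>commutes_up_to_factor\<close> for \<open>a\<close>, \<open>b\<close> and for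
  \<open>b\<close>, \<open>a\<close> gives factors \<open>r\<close> and \<open>s\<close>; cancelling
  the products shows that they are mutually inverse.\<close>

lemma regular_comm_up_to_units: "comm_up_to_units (regular_monoid S)"
proof -
  interpret H: monoid_cancel "regular_monoid S" by (rule regular_monoid_cancel)
  have factor: "\<exists>r \<in> carrier S. a \<otimes> b = b \<otimes> a \<otimes> r"
    if ab: "a \<in> carrier S" "b \<in> carrier S" "a \<noteq> \<zero>" "b \<noteq> \<zero>" for a b
  proof -
    have "\<exists>r \<in> e ` carrier S. e a \<otimes>\<^bsub>Q\<^esub> e b = e b \<otimes>\<^bsub>Q\<^esub> e a \<otimes>\<^bsub>Q\<^esub> r"
      by (rule O.commutes_up_to_factor) (use denominators_acc ab in auto)
    then obtain r where "r \<in> carrier S" "e (a \<otimes> b) = e (b \<otimes> a \<otimes> r)" using ab by auto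
    then show ?thesis using ab by (metis e_eq_iff m_closed)
  qed
  have "\<exists>u \<in> Units (regular_monoid S). a \<otimes> b = b \<otimes> a \<otimes> u"
    if reg: "a \<in> regular_elements S" "b \<in> regular_elements S" for a b
  proof -
    have ab: "a \<in> carrier S" "b \<in> carrier S" "a \<noteq> \<zero>" "b \<noteq> \<zero>" using reg regular_eq by auto
    obtain r s where rs: "r \<in> carrier S" "s \<in> carrier S" "a \<otimes> b = b \<otimes> a \<otimes> r" "b \<otimes> a = a \<otimes> b \<otimes> s"
      using factor ab by metis
    have "(a \<otimes> b) \<otimes> (s \<otimes> r) = (a \<otimes> b) \<otimes> \<one>"
      using rs ab by (metis m_assoc m_closed r_one)
    then have "s \<otimes> r = \<one>"
      using regular_l_cancel[OF regular_mult_closed[OF reg]] rs(1,2) by blast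
    moreover have "(b \<otimes> a) \<otimes> (r \<otimes> s) = (b \<otimes> a) \<otimes> \<one>"
      using rs ab by (metis m_assoc m_closed r_one)
    then have "r \<otimes> s = \<one>"
      using regular_l_cancel[OF regular_mult_closed[OF reg(2,1)]] rs(1,2) by blast
    moreover from this have "r \<noteq> \<zero>" "s \<noteq> \<zero>" using rs one_not_zero by auto
    ultimately have "r \<in> Units (regular_monoid S)"
      using rs regular_eq by (auto simp: Units_def)
    then show ?thesis using rs by blast
  qed
  then show ?thesis by unfold_locales simp
qed

end

theorem corollary1p4:
  fixes R :: "('a, 'm) ring_scheme" and S :: "('b, 'n) ring_scheme"
  shows "(comm_krull_ring R \<and> additively_regular R \<longrightarrow>
            (length_factorial (regular_monoid R) \<longleftrightarrow> factorial (regular_monoid R))) \<and>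
         (krull_ring S \<and> normalizing S \<longrightarrow>
            (length_factorial (reduced_monoid (regular_monoid S)) \<longleftrightarrow>
             factorial (reduced_monoid (regular_monoid S))))"
proof (intro conjI impI)
  assume "comm_krull_ring R \<and> additively_regular R"
  then interpret cring R by (simp add: comm_krull_ring_def)
  show "length_factorial (regular_monoid R) \<longleftrightarrow> factorial (regular_monoid R)"
    using comm_up_to_units.length_factorial_iff_factorial regular_comm_up_to_units
      exchange_additively_regular \<open>comm_krull_ring R \<and> additively_regular R\<close> by blast
next
  assume S: "krull_ring S \<and> normalizing S"
  then obtain Q :: "('b \<times> 'b) set ring" and e where Qe: "is_quotient_ring S Q e"
      "maximal_order S Q e" "ascending_chain_condition {I. divisorial S Q e I}"
    by (auto simp: krull_ring_def)
  interpret normalizing_krull_ring S Q e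
    using S Qe by (auto simp: krull_ring_def prime_ring_def normalizing_krull_ring_def
        normalizing_prime_ring_def normalizing_prime_ring_axioms_def normalizing_krull_ring_axioms_def)
  interpret H: comm_up_to_units "regular_monoid S" by (rule regular_comm_up_to_units)
  \<comment> \<open>The claim concerns the reduced monoid, whose factorizations are formed in its
    own reduction. So the criterion is applied to the reduced monoid itself, which is commutative
    and inherits \<open>exchange\<close>.\<close>
  interpret M: comm_monoid_cancel "reduced_monoid (regular_monoid S)"
    by (rule H.reduced_comm_monoid_cancel)
  show "length_factorial (reduced_monoid (regular_monoid S)) \<longleftrightarrow>
      factorial (reduced_monoid (regular_monoid S))"
    by (intro comm_up_to_units.length_factorial_iff_factorial M.is_comm_up_to_units
        H.exchange_reduced exchange_domain H.comm_up_to_units_axioms)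
qed

end
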